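(* Let $g\geq 2$ and $0\leq i\leq g-2$ be integers, and let $d$ be an integer with $|d|=g+i$. Then there exist a triangulation $K$ of the closed orientable surface of genus $g$ with exactly $6|d|+1$ vertices, an orientation of $K$, and a simplicial map $f:K\to\mathbb{T}^2$ of degree $d$, where $\mathbb{T}^2$ denotes the $7$-vertex triangulated torus with a fixed orientation.
   Context: A triangulation of a surface $M$ is a finite (abstract or geometric) simplicial complex whose geometric carrier is homeomorphic to $M$. A simplicial map $f:K\to L$ is a map of vertex sets sending the vertices of every simplex of $K$ to the vertices of a simplex of $L$ (possibly of lower dimension). The $7$-vertex triangulated torus $\mathbb{T}^2$ is the simplicial complex on vertices $v_1,\dots,v_7$ with the $14$ triangles $[v_1v_2v_4]$, $[v_2v_4v_5]$, $[v_2v_3v_5]$, $[v_3v_5v_6]$, $[v_1v_5v_6]$, $[v_1v_2v_6]$, $[v_2v_6v_7]$, $[v_2v_3v_7]$, $[v_1v_3v_7]$, $[v_1v_5v_7]$, $[v_4v_5v_7]$, $[v_4v_6v_7]$, $[v_3v_4v_6]$, $[v_1v_3v_4]$; it is oriented so that $[v_1v_2v_4]$, with vertex order $v_1<v_2<v_4$, is positively oriented. For closed connected oriented triangulated surfaces $K,L$ with fundamental classes $[a]\in H_2(K;\mathbb{Z})\cong\mathbb{Z}$ and $[b]\in H_2(L;\mathbb{Z})\cong\mathbb{Z}$, the degree of a simplicial map $f:K\to L$ is the integer $d$ with $f_*([a])=d\cdot[b]$. The orientation of the domain $K$ may be chosen freely (so reversing it changes $d$ to $-d$). *)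

theory Defs
  imports
    "HOL-Analysis.Analysis"
    "HOL-Algebra.Coset"
    "HOL-Combinatorics.Permutations"
begin

section \<open>Abstract simplicial complexes\<close>

definition abstract_complex :: "'v set set \<Rightarrow> bool" where
  "abstract_complex K \<longleftrightarrow>
     finite K \<and> (\<forall>\<sigma>\<in>K. finite \<sigma> \<and> \<sigma> \<noteq> {}) \<and>
     (\<forall>\<sigma>\<in>K. \<forall>\<tau>. \<tau> \<subseteq> \<sigma> \<and> \<tau> \<noteq> {} \<longrightarrow> \<tau> \<in> K)"

abbreviation vertices :: "'v set set \<Rightarrow> 'v set" where
  "vertices K \<equiv> \<Union>K"

text \<open>Points are given by barycentric coordinates. The topology is that of pointwise
  convergence, which on the carrier of a finite complex is the Euclidean one.\<close>

definition geometric_carrier :: "'v set set \<Rightarrow> ('v \<Rightarrow> real) topology" where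
  "geometric_carrier K =
     top_of_set {x. (\<forall>v. 0 \<le> x v) \<and> {v. x v \<noteq> 0} \<in> K \<and> (\<Sum>v | x v \<noteq> 0. x v) = 1}"

definition simplicial_map :: "'v set set \<Rightarrow> 'w set set \<Rightarrow> ('v \<Rightarrow> 'w) \<Rightarrow> bool" where
  "simplicial_map K L f \<longleftrightarrow> (\<forall>\<sigma>\<in>K. f ` \<sigma> \<in> L)"

definition triangulation_of :: "'v set set \<Rightarrow> 'a topology \<Rightarrow> bool" where
  "triangulation_of K M \<longleftrightarrow> abstract_complex K \<and> geometric_carrier K homeomorphic_space M"


section \<open>Closed orientable surfaces\<close>

text \<open>\<open>X\<close> is obtained from \<open>Y1\<close> and \<open>Y2\<close> by removing the interior of an embedded closed
  disc from each and gluing what is left along the two boundary circles. The maps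
  \<open>h1\<close>, \<open>h2\<close> include the two pieces into \<open>X\<close>; since their images are closed and cover
  \<open>X\<close>, the topology of \<open>X\<close> is the quotient topology of the gluing.\<close>

definition connected_sum :: "'a topology \<Rightarrow> 'a topology \<Rightarrow> 'a topology \<Rightarrow> bool" where
  "connected_sum X Y1 Y2 \<longleftrightarrow>
     (\<exists>e1 e2 h1 h2 A1 A2.
        embedding_map (top_of_set (cball (0::complex) 1)) Y1 e1 \<and>
        embedding_map (top_of_set (cball (0::complex) 1)) Y2 e2 \<and>
        A1 = topspace Y1 - e1 ` ball 0 1 \<and>
        A2 = topspace Y2 - e2 ` ball 0 1 \<and>
        embedding_map (subtopology Y1 A1) X h1 \<and> closedin X (h1 ` A1) \<and>
        embedding_map (subtopology Y2 A2) X h2 \<and> closedin X (h2 ` A2) \<and>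
        h1 ` A1 \<union> h2 ` A2 = topspace X \<and>
        h1 ` A1 \<inter> h2 ` A2 = h1 ` e1 ` sphere 0 1 \<and>
        h1 ` A1 \<inter> h2 ` A2 = h2 ` e2 ` sphere 0 1)"

abbreviation circle :: "complex topology" where
  "circle \<equiv> top_of_set (sphere 0 1)"

text \<open>The closed orientable surface of genus \<open>g\<close> is the connected sum of \<open>g\<close> tori
  (the sphere if \<open>g = 0\<close>). All summands have the type of the resulting space; this loses
  nothing once that type has at least the cardinality of the continuum.\<close>

inductive closed_orientable_surface :: "nat \<Rightarrow> 'a topology \<Rightarrow> bool" where
  sphere: "X homeomorphic_space top_of_set (sphere (0 :: real^3) 1)
           \<Longrightarrow> closed_orientable_surface 0 X"
| torus: "X homeomorphic_space prod_topology circle circle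
           \<Longrightarrow> closed_orientable_surface 1 X"
| sum: "\<lbrakk>closed_orientable_surface m Y1; closed_orientable_surface n Y2;
          connected_sum X Y1 Y2\<rbrakk>
           \<Longrightarrow> closed_orientable_surface (m + n) X"


section \<open>Simplicial homology with integer coefficients\<close>

text \<open>A simplicial \<open>p\<close>-chain is an alternating function on the ordered \<open>p\<close>-simplices: \<open>c\<close>
  stands for the sum of \<open>c [v\<^sub>0, \<dots>, v\<^sub>p] \<cdot> [v\<^sub>0, \<dots>, v\<^sub>p]\<close> over the \<open>p\<close>-simplices, where the
  choice of an ordering of each simplex is immaterial.\<close>

definition simplicial_chains :: "nat \<Rightarrow> 'v set set \<Rightarrow> ('v list \<Rightarrow> int) set" where
  "simplicial_chains p K =
     {c. (\<forall>vs. c vs \<noteq> 0 \<longrightarrow> length vs = Suc p \<and> distinct vs \<and> set vs \<in> K) \<and>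
         (\<forall>vs \<pi>. \<pi> permutes {..<length vs} \<longrightarrow> c (permute_list \<pi> vs) = sign \<pi> * c vs)}"

text \<open>In \<open>\<partial>[v\<^sub>0, \<dots>, v\<^sub>p] = \<Sum>\<^sub>i (-1)\<^sup>i [v\<^sub>0, \<dots>, v\<^sub>i\<^sub>-\<^sub>1, v\<^sub>i\<^sub>+\<^sub>1, \<dots>, v\<^sub>p]\<close> the coefficient
  at \<open>ws\<close> comes from the simplices that can be ordered as \<open>v # ws\<close>. The boundary of a
  \<open>0\<close>-chain is \<open>0\<close>.\<close>

definition simplicial_boundary :: "'v set set \<Rightarrow> ('v list \<Rightarrow> int) \<Rightarrow> 'v list \<Rightarrow> int" where
  "simplicial_boundary K c ws = (if ws = [] then 0 else \<Sum>v\<in>vertices K. c (v # ws))"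

definition simplicial_cycles :: "nat \<Rightarrow> 'v set set \<Rightarrow> ('v list \<Rightarrow> int) set" where
  "simplicial_cycles p K = {c \<in> simplicial_chains p K. simplicial_boundary K c = (\<lambda>_. 0)}"

definition simplicial_boundaries :: "nat \<Rightarrow> 'v set set \<Rightarrow> ('v list \<Rightarrow> int) set" where
  "simplicial_boundaries p K = simplicial_boundary K ` simplicial_chains (Suc p) K"

definition simplicial_cycle_group :: "nat \<Rightarrow> 'v set set \<Rightarrow> ('v list \<Rightarrow> int) monoid" where
  "simplicial_cycle_group p K =
     \<lparr>carrier = simplicial_cycles p K, monoid.mult = (\<lambda>a b vs. a vs + b vs), one = (\<lambda>_. 0)\<rparr>"

definition simplicial_homology_group :: "nat \<Rightarrow> 'v set set \<Rightarrow> ('v list \<Rightarrow> int) set monoid" where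
  "simplicial_homology_group p K = simplicial_cycle_group p K Mod simplicial_boundaries p K"

definition simplicial_homology_class ::
    "nat \<Rightarrow> 'v set set \<Rightarrow> ('v list \<Rightarrow> int) \<Rightarrow> ('v list \<Rightarrow> int) set" where
  "simplicial_homology_class p K c =
     simplicial_boundaries p K #>\<^bsub>simplicial_cycle_group p K\<^esub> c"

text \<open>The linear extension of \<open>[v\<^sub>0, \<dots>, v\<^sub>p] \<mapsto> [f v\<^sub>0, \<dots>, f v\<^sub>p]\<close>. If \<open>ws\<close> has repeated
  entries, the summands cancel because \<open>c\<close> is alternating, so simplices collapsed by \<open>f\<close>
  contribute \<open>0\<close>.\<close>

definition simplicial_pushforward ::
    "'v set set \<Rightarrow> ('v \<Rightarrow> 'w) \<Rightarrow> ('v list \<Rightarrow> int) \<Rightarrow> 'w list \<Rightarrow> int" where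
  "simplicial_pushforward K f c ws = (\<Sum>vs | set vs \<in> K \<and> map f vs = ws. c vs)"

text \<open>The set product with the boundaries of \<open>L\<close> turns the image of a coset, which in
  general is only contained in a coset, into that coset.\<close>

definition simplicial_hom_induced ::
    "nat \<Rightarrow> 'v set set \<Rightarrow> 'w set set \<Rightarrow> ('v \<Rightarrow> 'w) \<Rightarrow> ('v list \<Rightarrow> int) set \<Rightarrow> ('w list \<Rightarrow> int) set"
  where
  "simplicial_hom_induced p K L f \<alpha> =
     simplicial_boundaries p L <#>\<^bsub>simplicial_cycle_group p L\<^esub> simplicial_pushforward K f ` \<alpha>"


section \<open>Orientations and degree\<close>

text \<open>An orientation of a closed triangulated surface is recorded by the function that is
  \<open>1\<close> on positively ordered triangles and \<open>-1\<close> on negatively ordered ones. As every edge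
  lies in exactly two triangles, a vanishing boundary says that adjacent triangles are
  oriented coherently. As a chain, this function is the sum of all positively oriented
  triangles, so its homology class is the fundamental class.\<close>

definition surface_orientation :: "'v set set \<Rightarrow> ('v list \<Rightarrow> int) \<Rightarrow> bool" where
  "surface_orientation K \<omega> \<longleftrightarrow>
     \<omega> \<in> simplicial_cycles 2 K \<and>
     (\<forall>vs. length vs = 3 \<and> distinct vs \<and> set vs \<in> K \<longrightarrow> \<omega> vs = 1 \<or> \<omega> vs = -1)"

abbreviation fundamental_class :: "'v set set \<Rightarrow> ('v list \<Rightarrow> int) \<Rightarrow> ('v list \<Rightarrow> int) set" where
  "fundamental_class K \<omega> \<equiv> simplicial_homology_class 2 K \<omega>"

definition has_simplicial_degree ::
    "'v set set \<Rightarrow> ('v list \<Rightarrow> int) \<Rightarrow> 'w set set \<Rightarrow> ('w list \<Rightarrow> int) \<Rightarrow> ('v \<Rightarrow> 'w) \<Rightarrow> int \<Rightarrow> bool"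
  where
  "has_simplicial_degree K \<omega>K L \<omega>L f d \<longleftrightarrow>
     simplicial_hom_induced 2 K L f (fundamental_class K \<omega>K) =
     fundamental_class L \<omega>L [^]\<^bsub>simplicial_homology_group 2 L\<^esub> d"


section \<open>The 7-vertex torus\<close>

text \<open>The vertex \<open>v\<^sub>j\<close> is the number \<open>j\<close>. Each triangle is listed in the vertex order that is
  positive when \<open>[1, 2, 4]\<close> is.\<close>

definition torus7_triangles :: "nat list list" where
  "torus7_triangles =
     [[1,2,4], [2,5,4], [2,3,5], [3,6,5], [1,5,6], [1,6,2], [2,6,7],
      [2,7,3], [1,3,7], [1,7,5], [4,5,7], [4,7,6], [3,4,6], [1,4,3]]"

definition torus7 :: "nat set set" where
  "torus7 = {\<sigma>. \<sigma> \<noteq> {} \<and> (\<exists>t\<in>set torus7_triangles. \<sigma> \<subseteq> set t)}"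

definition torus7_orientation :: "nat list \<Rightarrow> int" where
  "torus7_orientation vs =
     (if \<exists>n. rotate n vs \<in> set torus7_triangles then 1
      else if \<exists>n. rotate n (rev vs) \<in> set torus7_triangles then -1
      else 0)"

end

theory Submission
  imports Defs
begin

text \<open>
  The surfaces are built one handle at a time. For \<open>n \<ge> 7\<close> the triangles
  \<open>{a, a + 1, a + 3}\<close> and \<open>{a, a + 2, a + 3}\<close> on the vertex set \<open>\<int>/n\<close> form a torus: it is the
  triangular lattice modulo a sublattice of index \<open>n\<close> (\<open>cyclic_torus_homeomorphic\<close>). For \<open>n = 7\<close>
  this is \<open>T\<^sup>2\<close> itself via \<open>a \<mapsto> a + 1\<close>, and for \<open>n = 14\<close> reduction modulo 7 is a double cover of it.

  To add such a torus \<open>L\<close> to a surface \<open>K\<close> that is already mapped to \<open>T\<^sup>2\<close>, cut both along a path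
  \<open>p - r - q\<close> with the same image and glue the four banks crosswise. The genus goes up by one, the
  degrees add up, and since only \<open>p\<close> and \<open>q\<close> are identified, two vertices are lost. The result is
  a simplicial complex as long as \<open>p\<close> and \<open>q\<close> are not adjacent in \<open>L\<close>. They are not adjacent for
  \<open>n = 14\<close>, which gives 12 more vertices for two more sheets. All vertices of the 7-vertex torus are
  adjacent, so there the edge \<open>pq\<close> is first subdivided, which gives 6 more vertices for one more
  sheet. Hence every step costs 6 vertices per sheet; starting from the 7-vertex torus, \<open>i\<close> steps of
  the first kind and \<open>g - 1 - i\<close> steps of the second kind lead to genus \<open>g\<close>, degree \<open>g + i\<close> and
  \<open>6 (g + i) + 1\<close> vertices.

  The cut and paste becomes a connected sum along a disc when \<open>p\<close> and \<open>q\<close> have a common neighbour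
  \<open>w\<close> such that \<open>rwp\<close> and \<open>rwq\<close> are triangles, in \<open>K\<close> as well as in \<open>L\<close>. The two triangles of \<open>K\<close> form
  a disc, and the gluing only replaces this disc by a torus with a hole. If the hole is filled with the disc, the result
  is \<open>L\<close> with the edge \<open>rw\<close> subdivided twice, the two new vertices being the \<open>w\<close> and the \<open>r\<close> of \<open>K\<close>.
  Therefore the genus is settled by a statement about two complexes that meet in two triangles
  (\<open>connected_sum_along_quad\<close>) and by invariance of the carrier under edge subdivision
  (\<open>subdivide_edge_homeomorphic\<close>). In the subdivided torus the two triangles are traversed
  backwards, so the sum of the two fundamental cycles vanishes on the disc and is the fundamental
  cycle of the new surface; its image has the sum of the degrees because pushing forward is linear
  (\<open>glue_torus_piece\<close>). The new surface contains another pair of triangles with the same images, so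
  that the step can be repeated.
\<close>

section \<open>Carriers of simplicial complexes\<close>

definition points :: "'v set set \<Rightarrow> ('v \<Rightarrow> real) set" where
  "points K = {x. (\<forall>v. 0 \<le> x v) \<and> {v. x v \<noteq> 0} \<in> K \<and> (\<Sum>v | x v \<noteq> 0. x v) = 1}"

definition complex_of :: "'v list list \<Rightarrow> 'v set set" where
  "complex_of ts = {\<sigma>. \<sigma> \<noteq> {} \<and> (\<exists>t\<in>set ts. \<sigma> \<subseteq> set t)}"

lemma geometric_carrier_points: "geometric_carrier K = top_of_set (points K)"
  by (simp add: geometric_carrier_def points_def)

lemma abstract_complex_complex_of: "abstract_complex (complex_of ts)"
proof -
  have "complex_of ts \<subseteq> (\<Union>t\<in>set ts. Pow (set t))"
    by (auto simp: complex_of_def)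
  then have "finite (complex_of ts)"
    by (rule finite_subset) auto
  moreover have "\<forall>\<sigma>\<in>complex_of ts. finite \<sigma> \<and> \<sigma> \<noteq> {}"
    by (auto simp: complex_of_def intro: finite_subset)
  moreover have "\<forall>\<sigma>\<in>complex_of ts. \<forall>\<tau>. \<tau> \<subseteq> \<sigma> \<and> \<tau> \<noteq> {} \<longrightarrow> \<tau> \<in> complex_of ts"
    unfolding complex_of_def by blast
  ultimately show ?thesis unfolding abstract_complex_def by (intro conjI)
qed

lemma abstract_complexD:
  assumes "abstract_complex K"
  shows "finite K" "\<And>\<sigma>. \<sigma> \<in> K \<Longrightarrow> finite \<sigma>" "\<And>\<sigma>. \<sigma> \<in> K \<Longrightarrow> \<sigma> \<noteq> {}"
    "\<And>\<sigma> \<tau>. \<sigma> \<in> K \<Longrightarrow> \<tau> \<subseteq> \<sigma> \<Longrightarrow> \<tau> \<noteq> {} \<Longrightarrow> \<tau> \<in> K"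
proof -
  note * = assms[unfolded abstract_complex_def]
  show "finite K" by (rule *[THEN conjunct1])
  show "finite \<sigma>" "\<sigma> \<noteq> {}" if "\<sigma> \<in> K" for \<sigma>
    using bspec[OF *[THEN conjunct2, THEN conjunct1] that] by simp_all
  show "\<tau> \<in> K" if "\<sigma> \<in> K" "\<tau> \<subseteq> \<sigma>" "\<tau> \<noteq> {}" for \<sigma> \<tau>
    by (rule *[THEN conjunct2, THEN conjunct2, rule_format, OF that(1)]) (simp add: that)
qed

lemma abstract_complex_Un:
  assumes K: "abstract_complex K" and L: "abstract_complex L"
  shows "abstract_complex (K \<union> L)"
  unfolding abstract_complex_def
proof (intro conjI ballI allI impI)
  fix \<sigma> \<tau> assume "\<sigma> \<in> K \<union> L" "\<tau> \<subseteq> \<sigma> \<and> \<tau> \<noteq> {}"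
  then show "\<tau> \<in> K \<union> L" using abstract_complexD(4)[OF K] abstract_complexD(4)[OF L] by blast
qed (use abstract_complexD(1-3)[OF K] abstract_complexD(1-3)[OF L] in auto)

lemma abstract_complex_finite:
  assumes "abstract_complex K"
  shows "finite K" "finite (vertices K)"
  using abstract_complexD(1,2)[OF assms] by (simp_all add: finite_Union)

lemma Hausdorff_geometric_carrier: "Hausdorff_space (geometric_carrier K)"
  unfolding geometric_carrier_def euclidean_product_topology[symmetric]
  by (intro Hausdorff_space_subtopology) (simp add: Hausdorff_space_product_topology)

lemma sum_support:
  fixes x :: "'v \<Rightarrow> real"
  assumes "finite U" "\<And>v. x v \<noteq> 0 \<Longrightarrow> v \<in> U"
  shows "(\<Sum>v | x v \<noteq> 0. x v) = sum x U"
  by (rule sum.mono_neutral_left) (use assms in auto)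

text \<open>It suffices that the support lies in some simplex: faces of simplices are simplices, and a
  support is nonempty because the coordinates sum to 1. This form is stable under linear maps,
  which seldom allow one to tell the support exactly.\<close>
lemma points_iff:
  assumes K: "abstract_complex K" and U: "finite U" "vertices K \<subseteq> U"
  shows "x \<in> points K \<longleftrightarrow>
     (\<forall>v. 0 \<le> x v) \<and> (\<exists>\<sigma>\<in>K. \<forall>v. x v \<noteq> 0 \<longrightarrow> v \<in> \<sigma>) \<and> sum x U = 1"
proof
  assume x: "x \<in> points K"
  then have "\<And>v. x v \<noteq> 0 \<Longrightarrow> v \<in> U" using U by (auto simp: points_def)
  from sum_support[OF U(1) this] x have "(\<forall>v. 0 \<le> x v) \<and> sum x U = 1" "{v. x v \<noteq> 0} \<in> K"
    by (simp_all add: points_def)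
  moreover from this(2) have "\<exists>\<sigma>\<in>K. \<forall>v. x v \<noteq> 0 \<longrightarrow> v \<in> \<sigma>"
    by (rule rev_bexI) simp
  ultimately show "(\<forall>v. 0 \<le> x v) \<and> (\<exists>\<sigma>\<in>K. \<forall>v. x v \<noteq> 0 \<longrightarrow> v \<in> \<sigma>) \<and> sum x U = 1"
    by simp
next
  assume r: "(\<forall>v. 0 \<le> x v) \<and> (\<exists>\<sigma>\<in>K. \<forall>v. x v \<noteq> 0 \<longrightarrow> v \<in> \<sigma>) \<and> sum x U = 1"
  then obtain \<sigma> where \<sigma>': "\<sigma> \<in> K" "\<forall>v. x v \<noteq> 0 \<longrightarrow> v \<in> \<sigma>" by blast
  then have \<sigma>: "\<sigma> \<in> K" "{v. x v \<noteq> 0} \<subseteq> \<sigma>" by simp_all blast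
  then have s: "\<And>v. x v \<noteq> 0 \<Longrightarrow> v \<in> U" using U by blast
  have "{v. x v \<noteq> 0} \<noteq> {}"
  proof
    assume "{v. x v \<noteq> 0} = {}"
    then have "sum x U = 0" by auto
    with r show False by simp
  qed
  then have "{v. x v \<noteq> 0} \<in> K"
    using abstract_complexD(4)[OF K] \<sigma> by blast
  with r sum_support[OF U(1) s] show "x \<in> points K" by (simp add: points_def)
qed

lemma vertices_complex_of: "vertices (complex_of ts) = \<Union>(set ` set ts)"
proof (intro equalityI subsetI)
  fix v assume "v \<in> \<Union>(set ` set ts)"
  then obtain t where "t \<in> set ts" "v \<in> set t" by auto
  then have "set t \<in> complex_of ts" by (auto simp: complex_of_def)
  with \<open>v \<in> set t\<close> show "v \<in> vertices (complex_of ts)" by auto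
qed (auto simp: complex_of_def)

lemma points_complex_of_iff:
  assumes U: "finite U" "\<Union>(set ` set ts) \<subseteq> U"
  shows "x \<in> points (complex_of ts) \<longleftrightarrow>
     (\<forall>v. 0 \<le> x v) \<and> (\<exists>t\<in>set ts. \<forall>v. x v \<noteq> 0 \<longrightarrow> v \<in> set t) \<and> sum x U = 1"
proof -
  have "(\<exists>\<sigma>\<in>complex_of ts. P \<sigma>) = (\<exists>t\<in>set ts. P (set t))"
    if P: "\<And>\<sigma> \<tau>. P \<sigma> \<Longrightarrow> \<sigma> \<subseteq> \<tau> \<Longrightarrow> P \<tau>" and ne: "\<not> P {}" for P
  proof
    assume "\<exists>\<sigma>\<in>complex_of ts. P \<sigma>"
    then show "\<exists>t\<in>set ts. P (set t)" using P unfolding complex_of_def by blast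
  next
    assume "\<exists>t\<in>set ts. P (set t)"
    then obtain t where t: "t \<in> set ts" "P (set t)" by blast
    with ne have "set t \<in> complex_of ts" by (auto simp: complex_of_def)
    with t show "\<exists>\<sigma>\<in>complex_of ts. P \<sigma>" by blast
  qed
  note faces = this
  have *: "(\<exists>\<sigma>\<in>complex_of ts. \<forall>v. x v \<noteq> 0 \<longrightarrow> v \<in> \<sigma>) = (\<exists>t\<in>set ts. \<forall>v. x v \<noteq> 0 \<longrightarrow> v \<in> set t)"
    if sum: "sum x U = 1"
  proof (rule faces)
    show "\<not> (\<forall>v. x v \<noteq> 0 \<longrightarrow> v \<in> {})"
    proof
      assume "\<forall>v. x v \<noteq> 0 \<longrightarrow> v \<in> {}"
      then have "sum x U = 0" by simp
      with sum show False by simp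
    qed
  qed blast
  have "vertices (complex_of ts) \<subseteq> U"
    unfolding vertices_complex_of by (rule U(2))
  note p = points_iff[OF abstract_complex_complex_of U(1) this]
  show ?thesis
    by (rule trans[OF p]) (use * in argo)
qed

lemma continuous_on_coordinate [continuous_intros]:
  "continuous_on X (\<lambda>x::'v \<Rightarrow> real. x v)"
  by (rule continuous_on_subset[OF continuous_on_product_coordinates subset_UNIV])

text \<open>The carrier is a finite union of closed geometric simplices.\<close>
lemma closed_points:
  assumes K: "abstract_complex K"
  shows "closed (points K)"
proof -
  let ?U = "vertices K"
  note fin = abstract_complex_finite[OF K]
  have "points K = (\<Union>\<sigma>\<in>K. (\<Inter>v. {x. 0 \<le> x v}) \<inter> (\<Inter>v\<in>-\<sigma>. {x. x v = 0}) \<inter> {x. sum x ?U = 1})" (is "_ = ?R")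
  proof (rule Set.set_eqI)
    fix x
    have "x \<in> points K \<longleftrightarrow> (\<exists>\<sigma>\<in>K. (\<forall>v. 0 \<le> x v) \<and> (\<forall>v. v \<notin> \<sigma> \<longrightarrow> x v = 0) \<and> sum x ?U = 1)"
      unfolding points_iff[OF K fin(2) subset_refl] by meson
    also have "\<dots> \<longleftrightarrow> x \<in> ?R" by simp (simp add: Ball_def)
    finally show "x \<in> points K \<longleftrightarrow> x \<in> ?R" .
  qed
  moreover have "closed {x::'a \<Rightarrow> real. 0 \<le> x v}" for v
    by (rule closed_Collect_le[OF continuous_on_const continuous_on_product_coordinates])
  moreover have "closed {x::'a \<Rightarrow> real. x v = 0}" for v
    by (rule closed_Collect_eq[OF continuous_on_product_coordinates continuous_on_const])
  moreover have "closed {x::'a \<Rightarrow> real. sum x ?U = 1}"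
    by (rule closed_Collect_eq[OF continuous_on_sum[OF continuous_on_product_coordinates] continuous_on_const])
  ultimately show ?thesis
    using fin(1) by (simp add: closed_UN closed_Int closed_INT)
qed

lemma rename_homeomorphic:
  fixes \<rho> :: "'v \<Rightarrow> 'w"
  assumes inj: "inj_on \<rho> (\<Union>(set ` set ts))"
  shows "geometric_carrier (complex_of ts) homeomorphic_space
         geometric_carrier (complex_of (map (map \<rho>) ts))"
proof -
  define V where "V = \<Union>(set ` set ts)"
  have fV: "finite V" by (auto simp: V_def)
  note inj = inj[folded V_def]
  define W where "W = \<rho> ` V"
  have W: "W = \<Union>(set ` set (map (map \<rho>) ts))" by (auto simp: W_def V_def)
  define F where "F x = (\<lambda>w. if w \<in> W then x (inv_into V \<rho> w) else (0::real))" for x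
  define G where "G y = (\<lambda>v. if v \<in> V then y (\<rho> v) else (0::real))" for y
  have P: "x \<in> points (complex_of ts) \<longleftrightarrow>
     (\<forall>v. 0 \<le> x v) \<and> (\<exists>t\<in>set ts. \<forall>v. x v \<noteq> 0 \<longrightarrow> v \<in> set t) \<and> sum x V = 1" for x
    by (rule points_complex_of_iff[OF fV]) (simp add: V_def)
  have Q: "y \<in> points (complex_of (map (map \<rho>) ts)) \<longleftrightarrow>
     (\<forall>v. 0 \<le> y v) \<and> (\<exists>t\<in>set ts. \<forall>v. y v \<noteq> 0 \<longrightarrow> v \<in> \<rho> ` set t) \<and> sum y W = 1" for y
    by (subst points_complex_of_iff[of W]) (use fV W in \<open>auto simp: W_def\<close>)
  have sub: "t \<in> set ts \<Longrightarrow> set t \<subseteq> V" for t by (auto simp: V_def)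
  have FQ: "F x \<in> points (complex_of (map (map \<rho>) ts)) \<and> G (F x) = x"
    if x: "x \<in> points (complex_of ts)" for x
  proof -
    from x P obtain t where t: "t \<in> set ts" "\<And>v. x v \<noteq> 0 \<Longrightarrow> v \<in> set t" by auto
    have "sum (F x) W = sum x V"
      unfolding W_def by (subst sum.reindex[OF inj]) (auto simp: F_def W_def inj intro!: sum.cong)
    moreover have "\<forall>w. F x w \<noteq> 0 \<longrightarrow> w \<in> \<rho> ` set t"
      using t(2) by (auto simp: F_def W_def inj split: if_splits)
    moreover have "G (F x) = x"
      using t sub[OF t(1)] inj by (auto simp: G_def F_def W_def fun_eq_iff)
    moreover have "\<forall>w. 0 \<le> F x w" using x unfolding P F_def by simp
    ultimately show ?thesis
      using x t(1) unfolding P Q by (simp only: bex_simps set_map) blast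
  qed
  have GP: "G y \<in> points (complex_of ts) \<and> F (G y) = y"
    if y: "y \<in> points (complex_of (map (map \<rho>) ts))" for y
  proof -
    from y Q obtain t where t: "t \<in> set ts" "\<And>v. y v \<noteq> 0 \<Longrightarrow> v \<in> \<rho> ` set t" by auto
    have "sum (G y) V = sum y W"
      unfolding W_def by (subst sum.reindex[OF inj]) (auto simp: G_def intro!: sum.cong)
    moreover have "\<forall>v. G y v \<noteq> 0 \<longrightarrow> v \<in> set t"
      using t(2) inj sub[OF t(1)] by (auto simp: G_def inj_on_def split: if_splits)
    moreover have "F (G y) = y"
      using t(2) sub[OF t(1)]
      by (fastforce simp: G_def F_def W_def fun_eq_iff inj inv_into_into f_inv_into_f)
    moreover have "\<forall>w. 0 \<le> G y w" using y unfolding Q G_def by simp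
    ultimately show ?thesis
      using y t(1) unfolding P Q by (simp only: bex_simps set_map) blast
  qed
  have "continuous_on X F" for X
    unfolding F_def
  proof (rule continuous_on_coordinatewise_then_product)
    show "continuous_on X (\<lambda>x. if w \<in> W then x (inv_into V \<rho> w) else (0::real))" for w
      by (cases "w \<in> W") (simp_all add: continuous_on_coordinate)
  qed
  moreover have "continuous_on X G" for X
    unfolding G_def
  proof (rule continuous_on_coordinatewise_then_product)
    show "continuous_on X (\<lambda>y. if v \<in> V then y (\<rho> v) else (0::real))" for v
      by (cases "v \<in> V") (simp_all add: continuous_on_coordinate)
  qed
  ultimately have "homeomorphic_maps (geometric_carrier (complex_of ts))
     (geometric_carrier (complex_of (map (map \<rho>) ts))) F G"
    unfolding homeomorphic_maps_def geometric_carrier_points using FQ GP by auto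
  then show ?thesis by (auto simp: homeomorphic_space_def)
qed

text \<open>Each triangle through the edge is replaced by its two halves. Writing the new vertex at the
  place of the old one keeps the orientation.\<close>
definition subdivide_edge :: "'v \<Rightarrow> 'v \<Rightarrow> 'v \<Rightarrow> 'v list list \<Rightarrow> 'v list list" where
  "subdivide_edge a b m ts = concat (map (\<lambda>t. if a \<in> set t \<and> b \<in> set t
     then [map (id(a := m)) t, map (id(b := m)) t] else [t]) ts)"

text \<open>Put the new vertex at the midpoint of the edge and extend linearly. The inverse takes the
  largest multiple of the midpoint out of a point that leaves its coordinates nonnegative.\<close>
lemma subdivide_edge_homeomorphic:
  assumes ab: "a \<noteq> b" and m: "m \<notin> insert a (insert b (\<Union>(set ` set ts)))"
  shows "geometric_carrier (complex_of (subdivide_edge a b m ts)) homeomorphic_space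
         geometric_carrier (complex_of ts)"
proof -
  define V where "V = \<Union>(set ` set ts) \<union> {a, b} - {m}"
  define U where "U = insert m V"
  define R where "R = V - {a, b}"
  have V: "finite V" "m \<notin> V" "finite R" "m \<notin> R" "a \<notin> R" "b \<notin> R" by (auto simp: V_def R_def)
  have mab: "m \<noteq> a" "m \<noteq> b" using m by auto
  then have Ue: "U = insert m (insert a (insert b R))" by (auto simp: U_def R_def V_def)
  have sumU: "sum x U = x m + x a + x b + sum x R" for x :: "'a \<Rightarrow> real"
    unfolding Ue using V mab ab by simp
  have fU: "finite U" using V U_def by simp
  define H where "H x = (\<lambda>v. if v = m then 0 else if v = a \<or> v = b then x v + x m / 2 else x v)"
    for x :: "'a \<Rightarrow> real"
  define G where "G y = (\<lambda>v. if v = m then 2 * min (y a) (y b)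
      else if v = a \<or> v = b then y v - min (y a) (y b) else y v)" for y :: "'a \<Rightarrow> real"
  have sub: "set t \<subseteq> U" "m \<notin> set t" if "t \<in> set ts" for t
    using that m by (auto simp: V_def U_def)
  have Q: "y \<in> points (complex_of ts) \<longleftrightarrow>
     (\<forall>v. 0 \<le> y v) \<and> (\<exists>t\<in>set ts. \<forall>v. y v \<noteq> 0 \<longrightarrow> v \<in> set t) \<and> sum y U = 1" for y
    by (rule points_complex_of_iff[OF fU]) (auto simp: U_def V_def)
  have P: "x \<in> points (complex_of (subdivide_edge a b m ts)) \<longleftrightarrow>
     (\<forall>v. 0 \<le> x v) \<and> (\<exists>t\<in>set (subdivide_edge a b m ts). \<forall>v. x v \<noteq> 0 \<longrightarrow> v \<in> set t)
      \<and> sum x U = 1" for x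
    by (rule points_complex_of_iff[OF fU])
      (auto simp: subdivide_edge_def U_def V_def split: if_splits)
  have HQ: "H x \<in> points (complex_of ts) \<and> G (H x) = x"
    if x: "x \<in> points (complex_of (subdivide_edge a b m ts))" for x
  proof -
    from x P have nn: "\<And>v. 0 \<le> x v" and sx: "sum x U = 1" by auto
    from x P obtain s where s: "s \<in> set (subdivide_edge a b m ts)" "\<And>v. x v \<noteq> 0 \<Longrightarrow> v \<in> set s"
      by auto
    from s(1) obtain t where t: "t \<in> set ts" and
      st: "if a \<in> set t \<and> b \<in> set t then s = map (id(a := m)) t \<or> s = map (id(b := m)) t else s = t"
      by (auto simp: subdivide_edge_def split: if_splits)
    have min0: "min (x a) (x b) = 0" and xt: "\<And>v. x v \<noteq> 0 \<Longrightarrow> v \<noteq> m \<Longrightarrow> v \<in> set t"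
      and xm: "x m \<noteq> 0 \<Longrightarrow> a \<in> set t \<and> b \<in> set t"
    proof -
      consider "s = t" "a \<notin> set t \<or> b \<notin> set t" | c where "c = a \<or> c = b" "a \<in> set t" "b \<in> set t"
          "set s = insert m (set t - {c})"
      proof (cases "a \<in> set t \<and> b \<in> set t")
        case True
        have "set (map (id(c := m)) t) = insert m (set t - {c})" if "c \<in> set t" for c
          using that by auto
        with True st that(2) show ?thesis by (metis (no_types))
      qed (use st that(1) in auto)
      then have *: "(x a = 0 \<or> x b = 0) \<and> (\<forall>v. x v \<noteq> 0 \<longrightarrow> v \<noteq> m \<longrightarrow> v \<in> set t) \<and>
          (x m \<noteq> 0 \<longrightarrow> a \<in> set t \<and> b \<in> set t)"
        by cases (use s(2) sub(2)[OF t] mab in auto)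
      with nn[of a] nn[of b] show "min (x a) (x b) = 0" by (auto simp: min_def)
      show "v \<in> set t" if "x v \<noteq> 0" "v \<noteq> m" for v using * that by blast
      show "a \<in> set t \<and> b \<in> set t" if "x m \<noteq> 0" using * that by blast
    qed
    have "sum (H x) U = sum x U"
    proof -
      have "sum (H x) R = sum x R" using V by (intro sum.cong) (auto simp: H_def)
      then show ?thesis unfolding sumU using mab ab by (simp add: H_def)
    qed
    moreover have "\<forall>v. H x v \<noteq> 0 \<longrightarrow> v \<in> set t" using xt xm unfolding H_def by (metis add_0 divide_eq_0_iff)
    moreover have "G (H x) = x"
      using min0 mab ab by (auto simp: G_def H_def fun_eq_iff min_def split: if_splits)
    moreover have "\<forall>v. 0 \<le> H x v" using nn by (simp add: H_def)
    ultimately show ?thesis using sx t unfolding Q by metis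
  qed
  have GP: "G y \<in> points (complex_of (subdivide_edge a b m ts)) \<and> H (G y) = y"
    if y: "y \<in> points (complex_of ts)" for y
  proof -
    from y Q have nn: "\<And>v. 0 \<le> y v" and sy: "sum y U = 1" by auto
    from y Q obtain t where t: "t \<in> set ts" "\<And>v. y v \<noteq> 0 \<Longrightarrow> v \<in> set t" by auto
    have ym: "y m = 0" using t sub by blast
    have "sum (G y) U = sum y U"
    proof -
      have "sum (G y) R = sum y R" using V by (intro sum.cong) (auto simp: G_def)
      then show ?thesis unfolding sumU using mab ab ym by (simp add: G_def)
    qed
    moreover have "\<exists>s\<in>set (subdivide_edge a b m ts). \<forall>v. G y v \<noteq> 0 \<longrightarrow> v \<in> set s"
    proof (cases "a \<in> set t \<and> b \<in> set t")
      case True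
      define c where "c = (if y a \<le> y b then a else b)"
      have "map (id(c := m)) t \<in> set (subdivide_edge a b m ts)"
        using True t(1) unfolding subdivide_edge_def c_def by (auto intro!: bexI[of _ t])
      moreover have "\<forall>v. G y v \<noteq> 0 \<longrightarrow> v \<in> set (map (id(c := m)) t)"
        using t(2) True by (auto simp: G_def c_def min_def image_iff split: if_splits)
      ultimately show ?thesis by blast
    next
      case False
      then have "t \<in> set (subdivide_edge a b m ts)"
        using t(1) unfolding subdivide_edge_def by (auto intro!: bexI[of _ t])
      moreover have "min (y a) (y b) = 0"
        using False t(2)[of a] t(2)[of b] nn[of a] nn[of b] by (metis min.absorb1 min.absorb2)
      then have "\<forall>v. G y v \<noteq> 0 \<longrightarrow> v \<in> set t"
        using t(2) by (auto simp: G_def split: if_splits)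
      ultimately show ?thesis by blast
    qed
    moreover have "H (G y) = y" using mab ab ym by (auto simp: G_def H_def fun_eq_iff)
    moreover have "0 \<le> G y v" for v using nn[of a] nn[of b] nn[of v] by (auto simp: G_def min_def)
    ultimately show ?thesis using sy unfolding P by auto
  qed
  have "continuous_on X H" for X
  proof (rule continuous_on_coordinatewise_then_product)
    fix v
    consider "v = m" | "v \<noteq> m" "v = a \<or> v = b" | "v \<noteq> m" "v \<noteq> a" "v \<noteq> b" by blast
    then show "continuous_on X (\<lambda>x. H x v)"
      by cases (simp_all add: H_def continuous_intros)
  qed
  moreover have "continuous_on X G" for X
  proof (rule continuous_on_coordinatewise_then_product)
    fix v
    consider "v = m" | "v \<noteq> m" "v = a \<or> v = b" | "v \<noteq> m" "v \<noteq> a" "v \<noteq> b" by blast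
    then show "continuous_on X (\<lambda>x. G x v)"
      by cases (simp_all add: G_def continuous_intros)
  qed
  ultimately have "homeomorphic_maps (geometric_carrier (complex_of (subdivide_edge a b m ts)))
     (geometric_carrier (complex_of ts)) H G"
    unfolding homeomorphic_maps_def geometric_carrier_points using HQ GP by auto
  then show ?thesis by (auto simp: homeomorphic_space_def)
qed

section \<open>Connected sums along two triangles\<close>

definition quad :: "'v \<Rightarrow> 'v \<Rightarrow> 'v \<Rightarrow> 'v \<Rightarrow> 'v set set" where
  "quad p q r w = complex_of [[r, w, p], [r, w, q]]"

definition quad_interior :: "'v \<Rightarrow> 'v \<Rightarrow> 'v \<Rightarrow> 'v \<Rightarrow> 'v set set" where
  "quad_interior p q r w = {{r, w}, {r, w, p}, {r, w, q}}"

text \<open>The coordinates \<open>x * \<bar>x\<bar>\<close> and \<open>y * \<bar>y\<bar>\<close> carry the unit disc onto the square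
  \<open>\<bar>X\<bar> + \<bar>Y\<bar> \<le> 1\<close>. This square consists of two triangles with the common side \<open>X = 0\<close>, and it is mapped
  linearly on each of them to the triangles \<open>rwp\<close> (\<open>X \<ge> 0\<close>) and \<open>rwq\<close> (\<open>X \<le> 0\<close>).\<close>
definition disc_to_quad :: "'v \<Rightarrow> 'v \<Rightarrow> 'v \<Rightarrow> 'v \<Rightarrow> complex \<Rightarrow> 'v \<Rightarrow> real" where
  "disc_to_quad p q r w z =
     (let x = Re z * \<bar>Re z\<bar>; y = Im z * \<bar>Im z\<bar> in
      (\<lambda>v. if v = p then max x 0 else if v = q then max (- x) 0
           else if v = r then (1 - \<bar>x\<bar> + y) / 2 else if v = w then (1 - \<bar>x\<bar> - y) / 2 else 0))"

lemma signed_square_inj: "x * \<bar>x\<bar> = y * \<bar>y\<bar> \<longleftrightarrow> x = (y::real)"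
proof
  assume *: "x * \<bar>x\<bar> = y * \<bar>y\<bar>"
  have "sgn (x * \<bar>x\<bar>) = sgn x" "sgn (y * \<bar>y\<bar>) = sgn y" by (auto simp: sgn_mult sgn_if)
  then have "sgn x = sgn y" using * by metis
  moreover have "\<bar>x\<bar> * \<bar>x\<bar> = \<bar>y\<bar> * \<bar>y\<bar>" using * by (metis abs_mult abs_abs)
  then have "\<bar>x\<bar> = \<bar>y\<bar>" by (simp add: abs_eq_iff square_eq_iff)
  ultimately show "x = y" by (metis sgn_mult_abs)
qed simp

lemma signed_square_surj: "\<exists>x. x * \<bar>x\<bar> = (y::real)"
  by (rule exI[of _ "sgn y * sqrt \<bar>y\<bar>"]) (auto simp: sgn_if abs_mult algebra_simps)

lemma norm_le_1_signed_squares: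
  "norm z \<le> 1 \<longleftrightarrow> \<bar>Re z * \<bar>Re z\<bar>\<bar> + \<bar>Im z * \<bar>Im z\<bar>\<bar> \<le> 1"
  "norm z < 1 \<longleftrightarrow> \<bar>Re z * \<bar>Re z\<bar>\<bar> + \<bar>Im z * \<bar>Im z\<bar>\<bar> < 1"
  by (simp_all add: cmod_def abs_mult power2_eq_square)

text \<open>The open disc corresponds to the points whose coordinates at \<open>r\<close> and \<open>w\<close> are both positive.\<close>
lemma quad_disc:
  assumes d: "distinct [p, q, r, w]"
  shows "inj_on (disc_to_quad p q r w) X"
    and "continuous_on X (disc_to_quad p q r w)"
    and "disc_to_quad p q r w ` cball 0 1 = points (quad p q r w)"
    and "disc_to_quad p q r w ` ball 0 1 = points (quad_interior p q r w)"
proof -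
  let ?e = "disc_to_quad p q r w"
  have ep: "?e z p = max (Re z * \<bar>Re z\<bar>) 0" and eq: "?e z q = max (- (Re z * \<bar>Re z\<bar>)) 0"
    and er: "?e z r = (1 - \<bar>Re z * \<bar>Re z\<bar>\<bar> + Im z * \<bar>Im z\<bar>) / 2"
    and ew: "?e z w = (1 - \<bar>Re z * \<bar>Re z\<bar>\<bar> - Im z * \<bar>Im z\<bar>) / 2"
    and eo: "v \<notin> {p, q, r, w} \<Longrightarrow> ?e z v = 0" for z v
    using d by (auto simp: disc_to_quad_def Let_def)
  show "inj_on ?e X"
  proof (rule inj_onI)
    fix z z' assume eq': "?e z = ?e z'"
    have "Re z * \<bar>Re z\<bar> = ?e z p - ?e z q" "Im z * \<bar>Im z\<bar> = ?e z r - ?e z w" for z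
      unfolding ep eq er ew by (auto simp: max_def field_simps)
    then have "Re z * \<bar>Re z\<bar> = Re z' * \<bar>Re z'\<bar>" "Im z * \<bar>Im z\<bar> = Im z' * \<bar>Im z'\<bar>"
      using eq' by metis+
    then show "z = z'" by (simp only: signed_square_inj complex_eq_iff)
  qed
  show "continuous_on X ?e"
  proof (rule continuous_on_coordinatewise_then_product)
    fix v
    consider "v = p" | "v = q" | "v = r" | "v = w" | "v \<notin> {p, q, r, w}" by blast
    then show "continuous_on X (\<lambda>z. ?e z v)"
      by cases (simp_all add: ep eq er ew eo continuous_intros)
  qed
  let ?U = "{p, q, r, w}"
  have sumU: "sum x ?U = x p + x q + x r + x w" for x :: "'a \<Rightarrow> real" using d by simp
  have P: "x \<in> points (quad p q r w) \<longleftrightarrow> (\<forall>v. 0 \<le> x v) \<and> (x p = 0 \<or> x q = 0) \<and>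
      (\<forall>v. v \<notin> ?U \<longrightarrow> x v = 0) \<and> x p + x q + x r + x w = 1" for x
    unfolding quad_def
    by (subst points_complex_of_iff[of ?U]) (use d in \<open>auto simp: sumU\<close>)
  have I: "x \<in> points (quad_interior p q r w) \<longleftrightarrow>
      x \<in> points (quad p q r w) \<and> 0 < x r \<and> 0 < x w" for x
  proof -
    have "quad_interior p q r w = {\<sigma> \<in> quad p q r w. r \<in> \<sigma> \<and> w \<in> \<sigma>}"
      using d by (auto simp: quad_interior_def quad_def complex_of_def)
    then show ?thesis unfolding points_def by (auto simp: less_le)
  qed
  have surj: "\<exists>z. ?e z = x" if "x \<in> points (quad p q r w)" for x
  proof -
    from that P have x: "\<forall>v. 0 \<le> x v" "x p = 0 \<or> x q = 0" "\<forall>v. v \<notin> ?U \<longrightarrow> x v = 0"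
      "x p + x q + x r + x w = 1" by auto
    obtain a b where ab: "a * \<bar>a\<bar> = x p - x q" "b * \<bar>b\<bar> = x r - x w"
      using signed_square_surj by metis
    have "?e (Complex a b) v = x v" for v
    proof -
      consider "v = p" | "v = q" | "v = r" | "v = w" | "v \<notin> {p, q, r, w}" by blast
      then show ?thesis
        using x(1)[rule_format, of p] x(1)[rule_format, of q] x(2-4)
        by cases (auto simp: ep eq er ew eo ab)
    qed
    then show ?thesis by blast
  qed
  have mem: "?e z \<in> points (quad p q r w) \<longleftrightarrow> norm z \<le> 1"
    "?e z \<in> points (quad_interior p q r w) \<longleftrightarrow> norm z < 1" for z
  proof -
    define x y where "x = Re z * \<bar>Re z\<bar>" and "y = Im z * \<bar>Im z\<bar>"
    note e = ep[of z, folded x_def] eq[of z, folded x_def] er[of z, folded x_def y_def]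
      ew[of z, folded x_def y_def] eo[of _ z]
    have "(\<forall>v. 0 \<le> ?e z v) \<longleftrightarrow> (\<forall>v\<in>?U. 0 \<le> ?e z v)" using e(5) by (metis order_refl)
    also have "\<dots> \<longleftrightarrow> \<bar>x\<bar> + \<bar>y\<bar> \<le> 1" by (auto simp: e)
    finally show 1: "?e z \<in> points (quad p q r w) \<longleftrightarrow> norm z \<le> 1"
      unfolding P norm_le_1_signed_squares x_def[symmetric] y_def[symmetric]
      using e(5) by (auto simp: e(1-4) max_def field_simps)
    show "?e z \<in> points (quad_interior p q r w) \<longleftrightarrow> norm z < 1"
      unfolding I 1 norm_le_1_signed_squares x_def[symmetric] y_def[symmetric] e by auto
  qed
  show "?e ` cball 0 1 = points (quad p q r w)"
    using surj mem(1) by (force simp: image_iff)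
  show "?e ` ball 0 1 = points (quad_interior p q r w)"
    using surj mem(2) I by (force simp: image_iff)
qed

lemma points_Int: "points (K \<inter> L) = points K \<inter> points L"
  and points_Diff: "points (K - L) = points K - points L"
  by (auto simp: points_def)

text \<open>All three carriers lie in the same space of coordinate functions, so the two pieces with
  the disc removed are simply subsets of the new carrier and both gluing maps are the identity.
  The condition on the edge \<open>rw\<close> says that removing its open star leaves a complex.\<close>
lemma connected_sum_along_quad:
  assumes K: "abstract_complex K" and L: "abstract_complex L" 
    and KL: "K \<inter> L = quad p q r w" and d: "distinct [p, q, r, w]"
    and Kq: "\<And>\<sigma>. \<sigma> \<in> K \<Longrightarrow> {r, w} \<subseteq> \<sigma> \<Longrightarrow> \<sigma> \<in> quad_interior p q r w"
    and Lq: "\<And>\<sigma>. \<sigma> \<in> L \<Longrightarrow> {r, w} \<subseteq> \<sigma> \<Longrightarrow> \<sigma> \<in> quad_interior p q r w"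
  shows "abstract_complex (K \<union> L - quad_interior p q r w)"
    and "connected_sum (geometric_carrier (K \<union> L - quad_interior p q r w))
           (geometric_carrier K) (geometric_carrier L)"
proof -
  let ?S = "quad_interior p q r w"
  let ?e = "disc_to_quad p q r w"
  have S: "{r, w} \<subseteq> \<sigma>" if "\<sigma> \<in> ?S" for \<sigma> using that by (auto simp: quad_interior_def)
  have face_closed: "abstract_complex (J - ?S)"
    if J: "abstract_complex J" and Jq: "\<And>\<sigma>. \<sigma> \<in> J \<Longrightarrow> {r, w} \<subseteq> \<sigma> \<Longrightarrow> \<sigma> \<in> ?S" for J
    unfolding abstract_complex_def
  proof (intro conjI ballI allI impI)
    fix \<sigma> \<tau> assume "\<sigma> \<in> J - ?S" "\<tau> \<subseteq> \<sigma> \<and> \<tau> \<noteq> {}"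
    then show "\<tau> \<in> J - ?S" using abstract_complexD(4)[OF J] Jq S by blast
  qed (use abstract_complexD(1-3)[OF J] in auto)
  have "abstract_complex (K \<union> L)" by (rule abstract_complex_Un[OF K L])
  then show X: "abstract_complex (K \<union> L - ?S)"
    by (rule face_closed) (use Kq Lq in blast)
  note KS = closed_points[OF face_closed[OF K Kq]] and LS = closed_points[OF face_closed[OF L Lq]]
  have SQ: "?S \<subseteq> quad p q r w" by (auto simp: quad_interior_def quad_def complex_of_def)
  have emb: "embedding_map (top_of_set (cball (0::complex) 1)) (geometric_carrier J) ?e"
    if "quad p q r w \<subseteq> J" for J
  proof (rule continuous_imp_embedding_map)
    show "compact_space (top_of_set (cball (0::complex) 1))"
      by (simp add: compact_space_subtopology)
    show "Hausdorff_space (geometric_carrier J)"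
      by (rule Hausdorff_geometric_carrier)
    have "points (quad p q r w) \<subseteq> points J" using that by (auto simp: points_def)
    then show "continuous_map (top_of_set (cball 0 1)) (geometric_carrier J) ?e"
      unfolding geometric_carrier_points using quad_disc[OF d] by auto
    show "inj_on ?e (topspace (top_of_set (cball 0 1)))" using quad_disc[OF d] by simp
  qed
  have incl: "embedding_map (subtopology (geometric_carrier J) (points (J - ?S)))
      (geometric_carrier (K \<union> L - ?S)) id" if "J \<subseteq> K \<union> L" for J
  proof -
    have "points (J - ?S) \<subseteq> points J" "points (J - ?S) \<subseteq> points (K \<union> L - ?S)"
      using that by (auto simp: points_def)
    then show ?thesis
      by (simp add: embedding_map_def geometric_carrier_points subtopology_subtopology Int_absorb1
          homeomorphic_map_id)
  qed
  have clo: "closedin (geometric_carrier (K \<union> L - ?S)) (points (J - ?S))"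
    if "J \<subseteq> K \<union> L" "closed (points (J - ?S))" for J
    unfolding geometric_carrier_points using that by (intro closed_subset) (auto simp: points_def)
  have sph: "?e ` sphere 0 1 = points (quad p q r w) - points ?S"
  proof -
    have "sphere 0 1 = cball (0::complex) 1 - ball 0 1" by auto
    then show ?thesis
      using inj_on_image_set_diff[OF quad_disc(1)[OF d, of UNIV]] quad_disc[OF d]
      by (metis subset_UNIV)
  qed
  have meet: "points (K - ?S) \<inter> points (L - ?S) = ?e ` sphere 0 1"
    unfolding sph points_Diff by (simp add: points_Int KL[symmetric]) blast
  have cover: "points (K - ?S) \<union> points (L - ?S) = points (K \<union> L - ?S)"
    by (auto simp: points_def)
  have sub: "quad p q r w \<subseteq> K" "quad p q r w \<subseteq> L" using KL by auto
  show "connected_sum (geometric_carrier (K \<union> L - ?S)) (geometric_carrier K) (geometric_carrier L)"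
    unfolding connected_sum_def
  proof (intro exI conjI)
    show "embedding_map (top_of_set (cball (0::complex) 1)) (geometric_carrier K) ?e"
      "embedding_map (top_of_set (cball (0::complex) 1)) (geometric_carrier L) ?e"
      by (fact emb[OF sub(1)] emb[OF sub(2)])+
    show "points (K - ?S) = topspace (geometric_carrier K) - ?e ` ball 0 1"
      "points (L - ?S) = topspace (geometric_carrier L) - ?e ` ball 0 1"
      by (simp_all add: geometric_carrier_points points_Diff quad_disc(4)[OF d])
    show "embedding_map (subtopology (geometric_carrier K) (points (K - ?S)))
       (geometric_carrier (K \<union> L - ?S)) id"
     "embedding_map (subtopology (geometric_carrier L) (points (L - ?S)))
       (geometric_carrier (K \<union> L - ?S)) id"
      by (rule incl; blast)+
    show "closedin (geometric_carrier (K \<union> L - ?S)) (id ` points (K - ?S))"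
      "closedin (geometric_carrier (K \<union> L - ?S)) (id ` points (L - ?S))"
      using clo[OF _ KS] clo[OF _ LS] by simp_all
  qed (simp_all add: meet cover geometric_carrier_points)
qed

section \<open>Quotients of the triangular lattice\<close>

text \<open>The triangles at \<open>a\<close> are the images of the two halves of the unit square at a lattice point
  \<open>(x, y)\<close> with \<open>a = x + 2y\<close> modulo \<open>n\<close>, cut along its diagonal. Both are listed
  counterclockwise.\<close>
definition cyclic_torus :: "nat \<Rightarrow> nat list list" where
  "cyclic_torus n = concat (map (\<lambda>a. [[a, (a + 1) mod n, (a + 3) mod n],
     [a, (a + 3) mod n, (a + 2) mod n]]) [0..<n])"

text \<open>The function that is linear on each triangle, 1 at the origin and 0 at the other points
  of the triangular lattice.\<close>
definition lattice_hat :: "real \<Rightarrow> real \<Rightarrow> real" where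
  "lattice_hat x y = max 0 (1 - max \<bar>x\<bar> (max \<bar>y\<bar> \<bar>x - y\<bar>))"

text \<open>On the strip \<open>[0, n] \<times> [0, 1]\<close>, the coordinate at the vertex \<open>k\<close> is the sum of the hats at the
  lattice points over \<open>k\<close>: these are \<open>(k + jn, 0)\<close> in the bottom row and \<open>(k - 2 + jn, 1)\<close> in the top
  row. A sum of hats is visibly continuous, which a definition triangle by triangle would not be.\<close>
definition strip_map :: "nat \<Rightarrow> real \<times> real \<Rightarrow> nat \<Rightarrow> real" where
  "strip_map n z k = (if k < n then
     (\<Sum>j\<in>{-1, 0, 1}. lattice_hat (fst z - real k - j * real n) (snd z) +
        lattice_hat (fst z - real k + 2 - j * real n) (snd z - 1)) else 0)"

text \<open>The strip is a fundamental domain for the lattice spanned by \<open>(n, 0)\<close> and \<open>(-2, 1)\<close>, the kernel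
  of \<open>(x, y) \<mapsto> x + 2y\<close> modulo \<open>n\<close>; these are the periods of this map.\<close>
definition torus_map :: "nat \<Rightarrow> real \<times> real \<Rightarrow> complex \<times> complex" where
  "torus_map n z = (cis (2 * pi * ((fst z + 2 * snd z) / n)), cis (2 * pi * snd z))"

text \<open>Barycentric coordinates of \<open>(\<xi>, \<eta>)\<close> in the unit square with the diagonal \<open>\<xi> = \<eta>\<close>. The corners
  \<open>(0, 0)\<close>, \<open>(1, 0)\<close>, \<open>(0, 1)\<close>, \<open>(1, 1)\<close> are numbered by \<open>x + 2y\<close>, and one of the two middle ones always
  has weight 0.\<close>
definition cell_weight :: "real \<Rightarrow> real \<Rightarrow> nat \<Rightarrow> real" where
  "cell_weight \<xi> \<eta> c = (if c = 0 then 1 - max \<xi> \<eta> else if c = 1 then max 0 (\<xi> - \<eta>)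
     else if c = 2 then max 0 (\<eta> - \<xi>) else if c = 3 then min \<xi> \<eta> else 0)"

definition cell_point :: "nat \<Rightarrow> nat \<Rightarrow> real \<Rightarrow> real \<Rightarrow> nat \<Rightarrow> real" where
  "cell_point n a \<xi> \<eta> k = (\<Sum>c<4. cell_weight \<xi> \<eta> c * of_bool (k = (a + c) mod n))"

lemma lattice_hat_bottom:
  assumes "0 \<le> \<xi>" "\<xi> \<le> 1" "0 \<le> \<eta>" "\<eta> \<le> 1"
  shows "lattice_hat (of_int i + \<xi>) \<eta> =
     of_bool (i = 0) * cell_weight \<xi> \<eta> 0 + of_bool (i + 1 = 0) * cell_weight \<xi> \<eta> 1"
proof -
  consider "i = 0" | "i = -1" | "i \<ge> 1" | "i \<le> -2" by linarith
  then show ?thesis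
  proof cases
    case 3
    then have "1 \<le> real_of_int i" by simp
    with 3 assms show ?thesis unfolding lattice_hat_def cell_weight_def by (simp add: max_def abs_if)
  next
    case 4
    then have "real_of_int i \<le> -2" by simp
    with 4 assms show ?thesis unfolding lattice_hat_def cell_weight_def by (simp add: max_def abs_if)
  qed (use assms in \<open>simp_all add: lattice_hat_def cell_weight_def max_def abs_if\<close>)
qed

lemma lattice_hat_top:
  assumes "0 \<le> \<xi>" "\<xi> \<le> 1" "0 \<le> \<eta>" "\<eta> \<le> 1"
  shows "lattice_hat (of_int i + \<xi>) (\<eta> - 1) =
     of_bool (i = 0) * cell_weight \<xi> \<eta> 2 + of_bool (i + 1 = 0) * cell_weight \<xi> \<eta> 3"
proof -
  consider "i = 0" | "i = -1" | "i \<ge> 1" | "i \<le> -2" by linarith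
  then show ?thesis
  proof cases
    case 3
    then have "1 \<le> real_of_int i" by simp
    with 3 assms show ?thesis unfolding lattice_hat_def cell_weight_def by (simp add: max_def abs_if)
  next
    case 4
    then have "real_of_int i \<le> -2" by simp
    with 4 assms show ?thesis unfolding lattice_hat_def cell_weight_def by (simp add: max_def abs_if)
  qed (use assms in \<open>simp_all add: lattice_hat_def cell_weight_def max_def min_def abs_if\<close>)
qed

text \<open>Only the hats at the four corners of the square reach into it.\<close>
lemma strip_map_cell:
  fixes \<xi> \<eta> :: real
  assumes n: "n \<ge> 7" and a: "a \<le> n" and "0 \<le> \<xi>" "\<xi> \<le> 1" "0 \<le> \<eta>" "\<eta> \<le> 1"
  shows "strip_map n (a + \<xi>, \<eta>) = cell_point n a \<xi> \<eta>"
proof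
  fix k
  show "strip_map n (a + \<xi>, \<eta>) k = cell_point n a \<xi> \<eta> k"
  proof (cases "k < n")
    case False
    have "k \<noteq> (a + c) mod n" for c using False n by (metis mod_less_divisor gr0I not_numeral_le_zero)
    then have "cell_point n a \<xi> \<eta> k = 0" by (simp add: cell_point_def)
    with False show ?thesis by (simp add: strip_map_def)
  next
    case True
    define d where "d = int a - int k"
    have ind: "of_bool (d + n + c = 0) + of_bool (d + c = 0) + of_bool (d - n + c = 0)
      = (of_bool (k = (a + c) mod n) :: real)" if "c \<le> 3" for c :: nat
    proof -
      have "(a + c) mod n = (if a + c < n then a + c else a + c - n)"
        using a n that by (simp add: mod_if)
      then show ?thesis using a n that True by (auto simp: d_def)
    qed
    have h: "lattice_hat (a + \<xi> - real k - j * real n) \<eta> =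
        of_bool (d - j * n = 0) * cell_weight \<xi> \<eta> 0 + of_bool (d - j * n + 1 = 0) * cell_weight \<xi> \<eta> 1"
      "lattice_hat (a + \<xi> - real k + 2 - j * real n) (\<eta> - 1) =
        of_bool (d - j * n + 2 = 0) * cell_weight \<xi> \<eta> 2 + of_bool (d - j * n + 3 = 0) * cell_weight \<xi> \<eta> 3"
      for j :: int
    proof -
      have 1: "a + \<xi> - real k - j * real n = of_int (d - j * n) + \<xi>"
        "a + \<xi> - real k + 2 - j * real n = of_int (d - j * n + 2) + \<xi>"
        by (simp_all add: d_def)
      show "lattice_hat (a + \<xi> - real k - j * real n) \<eta> =
        of_bool (d - j * n = 0) * cell_weight \<xi> \<eta> 0 + of_bool (d - j * n + 1 = 0) * cell_weight \<xi> \<eta> 1"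
        unfolding 1 by (rule lattice_hat_bottom) fact+
      show "lattice_hat (a + \<xi> - real k + 2 - j * real n) (\<eta> - 1) =
        of_bool (d - j * n + 2 = 0) * cell_weight \<xi> \<eta> 2 + of_bool (d - j * n + 3 = 0) * cell_weight \<xi> \<eta> 3"
        unfolding 1 by (subst lattice_hat_top) (use assms in \<open>simp_all add: add.assoc\<close>)
    qed
    have "strip_map n (a + \<xi>, \<eta>) k = (\<Sum>j\<in>{-1, 0, 1::int}.
        lattice_hat (a + \<xi> - real k - j * real n) \<eta> +
        lattice_hat (a + \<xi> - real k + 2 - j * real n) (\<eta> - 1))"
      using True by (simp add: strip_map_def)
    also have "\<dots> = cell_weight \<xi> \<eta> 0 * of_bool (k = (a + 0) mod n) +
       cell_weight \<xi> \<eta> 1 * of_bool (k = (a + 1) mod n) +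
       cell_weight \<xi> \<eta> 2 * of_bool (k = (a + 2) mod n) +
       cell_weight \<xi> \<eta> 3 * of_bool (k = (a + 3) mod n)"
      unfolding h using ind[of 0, symmetric] ind[of 1, symmetric] ind[of 2, symmetric] ind[of 3, symmetric]
      by (simp add: algebra_simps)
    also have "\<dots> = cell_point n a \<xi> \<eta> k"
      by (simp add: cell_point_def eval_nat_numeral)
    finally show ?thesis .
  qed
qed

lemma add_mod_eq_iff:
  fixes a i j n :: nat
  assumes "i < n" "j < n"
  shows "(a + i) mod n = (a + j) mod n \<longleftrightarrow> i = j"
proof
  assume *: "(a + i) mod n = (a + j) mod n"
  have "(int a + int i) mod int n = (int a + int j) mod int n"
    using arg_cong[OF *, of int] by (simp add: zmod_int)
  then have "(int i - int j) mod int n = 0"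
    by (metis add_diff_cancel_left diff_self mod_0 mod_diff_eq)
  then have "int n dvd int i - int j" by (simp add: dvd_eq_mod_eq_0)
  then have "int i - int j \<noteq> 0 \<Longrightarrow> \<bar>int n\<bar> \<le> \<bar>int i - int j\<bar>" by (rule dvd_imp_le_int[rotated])
  then show "i = j" using assms by linarith
qed simp

lemma cell_point_at:
  assumes "j < n" "n \<ge> 4"
  shows "cell_point n a \<xi> \<eta> ((a + j) mod n) = cell_weight \<xi> \<eta> j"
proof -
  have "cell_point n a \<xi> \<eta> ((a + j) mod n) = (\<Sum>c<4. if c = j then cell_weight \<xi> \<eta> j else 0)"
    unfolding cell_point_def using assms by (intro sum.cong) (auto simp: add_mod_eq_iff)
  also have "\<dots> = cell_weight \<xi> \<eta> j"
    by (auto simp: cell_weight_def)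
  finally show ?thesis .
qed

lemma cell_point_shift:
  assumes "a mod n = b mod n"
  shows "cell_point n a = cell_point n b"
proof -
  have "(a + c) mod n = (b + c) mod n" for c using assms by (metis mod_add_left_eq)
  then show ?thesis by (simp add: cell_point_def fun_eq_iff)
qed

text \<open>Each quotient map factors through the other.\<close>
lemma quotients_homeomorphic:
  assumes f: "quotient_map X Y f" and g: "quotient_map X Z g"
    and eq: "\<And>x y. x \<in> topspace X \<Longrightarrow> y \<in> topspace X \<Longrightarrow> f x = f y \<longleftrightarrow> g x = g y"
  shows "Y homeomorphic_space Z"
proof -
  obtain h where h: "continuous_map Y Z h" "\<And>x. x \<in> topspace X \<Longrightarrow> h (f x) = g x"
    using quotient_map_lift_exists[OF f quotient_imp_continuous_map[OF g]] eq by metis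
  obtain k where k: "continuous_map Z Y k" "\<And>x. x \<in> topspace X \<Longrightarrow> k (g x) = f x"
    using quotient_map_lift_exists[OF g quotient_imp_continuous_map[OF f]] eq by metis
  have "f ` topspace X = topspace Y" "g ` topspace X = topspace Z"
    using f g by (auto simp: quotient_map_def)
  then have "homeomorphic_maps Y Z h k"
    unfolding homeomorphic_maps_def using h k by (metis image_iff)
  then show ?thesis by (auto simp: homeomorphic_space_def)
qed

lemma cis_eq_iff: "cis (2 * pi * x) = cis (2 * pi * y) \<longleftrightarrow> (\<exists>k::int. x = y + k)"
proof -
  have "cis (2 * pi * x) = cis (2 * pi * y) \<longleftrightarrow> (\<exists>k::int. 2 * pi * x = 2 * pi * y + 2 * pi * k)"
    using sin_cos_eq_iff[of "2 * pi * x" "2 * pi * y"] by (auto simp: complex_eq_iff)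
  also have "\<dots> \<longleftrightarrow> (\<exists>k::int. x = y + k)"
    by (simp add: distrib_left[symmetric])
  finally show ?thesis .
qed

lemma torus_map_eq_iff:
  fixes x y x' y' :: real
  assumes n: "n > 0"
  shows "torus_map n (x, y) = torus_map n (x', y') \<longleftrightarrow>
    (\<exists>k::int. y = y' + k) \<and> (\<exists>k::int. x + 2 * y = x' + 2 * y' + k * n)"
  unfolding torus_map_def prod.inject cis_eq_iff using n by (auto simp: field_simps)

lemma cell_weight_facts:
  fixes \<xi> \<eta> :: real
  assumes "0 \<le> \<xi>" "\<xi> \<le> 1" "0 \<le> \<eta>" "\<eta> \<le> 1"
  shows "cell_weight \<xi> \<eta> j \<ge> 0"
    and "cell_weight \<xi> \<eta> 0 + cell_weight \<xi> \<eta> 1 + cell_weight \<xi> \<eta> 2 + cell_weight \<xi> \<eta> 3 = 1"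
    and "cell_weight \<xi> \<eta> 1 = 0 \<or> cell_weight \<xi> \<eta> 2 = 0"
    and "cell_weight \<xi> \<eta> 1 + cell_weight \<xi> \<eta> 3 = \<xi>"
    and "cell_weight \<xi> \<eta> 2 + cell_weight \<xi> \<eta> 3 = \<eta>"
    and "j > 3 \<Longrightarrow> cell_weight \<xi> \<eta> j = 0"
  using assms by (auto simp: cell_weight_def max_def min_def)

text \<open>Suppose that the squares at \<open>a\<close> and \<open>a + c\<close> contain the same point of the carrier. As \<open>n \<ge> 7\<close>, the
  vertex sets \<open>{a, \<dots>, a + 3}\<close> and \<open>{a + c, \<dots>, a + c + 3}\<close> overlap on one side only. If \<open>c \<le> 3\<close>,
  comparing the weights shows that \<open>\<xi> + 2 * \<eta>\<close>, the centre of mass of the vertices counted from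
  \<open>a\<close>, is the same in both squares and that \<open>\<eta>\<close> changes by 0 or 1. For \<open>4 \<le> c\<close> and \<open>c + 3 < n\<close>
  the squares have no vertex in common, and if \<open>c + 3 \<ge> n\<close> they exchange roles.\<close>
lemma cell_points_eq_imp:
  fixes a b c :: nat and \<xi> \<eta> \<xi>' \<eta>' :: real
  assumes n: "n \<ge> 7" and r: "0 \<le> \<xi>" "\<xi> \<le> 1" "0 \<le> \<eta>" "\<eta> \<le> 1"
    and r': "0 \<le> \<xi>'" "\<xi>' \<le> 1" "0 \<le> \<eta>'" "\<eta>' \<le> 1"
    and eq: "cell_point n a \<xi> \<eta> = cell_point n b \<xi>' \<eta>'"
    and b: "b mod n = (a + c) mod n" and c: "c < n"
  shows "(\<exists>k::int. \<eta> = \<eta>' + k) \<and> \<xi> + 2 * \<eta> = c + \<xi>' + 2 * \<eta>' \<or> c + 3 \<ge> n"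
proof -
  define A where "A = cell_weight \<xi> \<eta>"
  define B where "B = cell_weight \<xi>' \<eta>'"
  note fA = cell_weight_facts[OF r, folded A_def] and fB = cell_weight_facts[OF r', folded B_def]
  have w: "A j = B ((j + n - c) mod n)" if j: "j < n" for j
  proof -
    have "a + (c + (j + n - c)) = (a + j) + n" using c by simp
    then have "(a + j) mod n = (a + (c + (j + n - c))) mod n" by (metis mod_add_self2)
    also have "\<dots> = (a + c + (j + n - c) mod n) mod n"
      by (simp only: mod_add_right_eq add.assoc[symmetric])
    also have "\<dots> = (b + (j + n - c) mod n) mod n"
      using b by (metis mod_add_left_eq)
    finally have "cell_point n b \<xi>' \<eta>' ((a + j) mod n) = B ((j + n - c) mod n)"
      using cell_point_at[of "(j + n - c) mod n" n b] n by (simp add: B_def)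
    with cell_point_at[OF j, of a \<xi> \<eta>] n eq show ?thesis by (simp add: A_def)
  qed
  have lo: "A j = 0" if "j < c" "j + n - c > 3" for j
    using w[of j] that c fB(6) by simp
  have hi: "A (j + c) = B j" if "j + c < n" for j
    using w[of "j + c"] that by (simp add: mod_if)
  consider "c = 0" | "c = 1" | "c = 2" | "c = 3" | "4 \<le> c" "c + 3 < n" | "c + 3 \<ge> n" by linarith
  then show ?thesis
  proof cases
    case 1
    then have "\<xi> = \<xi>'" "\<eta> = \<eta>'" using hi[of 1] hi[of 2] hi[of 3] n fA(4,5) fB(4,5) by simp_all
    with 1 show ?thesis by (auto intro: exI[of _ 0])
  next
    case 2
    then have e: "A 0 = 0" "A 1 = B 0" "A 2 = B 1" "A 3 = B 2" "B 3 = 0"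
      using lo[of 0] hi[of 0] hi[of 1] hi[of 2] hi[of 3] fA(6)[of 4] n by (simp_all add: eval_nat_numeral)
    have "\<eta> = \<eta>' \<or> \<eta> = \<eta>' + 1" using e fA(2,3,5) fB(3,5) by auto
    then have "\<exists>k::int. \<eta> = \<eta>' + k" by (auto intro: exI[of _ 0] exI[of _ 1])
    moreover have "\<xi> + 2 * \<eta> = c + \<xi>' + 2 * \<eta>'" using 2 e fA(2,4,5) fB(2,4,5) by simp
    ultimately show ?thesis by blast
  next
    case 3
    then have e: "A 0 = 0" "A 1 = 0" "A 2 = B 0" "A 3 = B 1" "B 2 = 0" "B 3 = 0"
      using lo[of 0] lo[of 1] hi[of 0] hi[of 1] hi[of 2] hi[of 3] fA(6)[of 4] fA(6)[of 5] n
      by (simp_all add: eval_nat_numeral)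
    then have "\<eta> = 1" "\<eta>' = 0" using fA(2,5) fB(5) by simp_all
    then have "\<exists>k::int. \<eta> = \<eta>' + k" by (auto intro: exI[of _ 1])
    moreover have "\<xi> + 2 * \<eta> = c + \<xi>' + 2 * \<eta>'" using 3 e fA(2,4,5) fB(2,4,5) by simp
    ultimately show ?thesis by blast
  next
    case 4
    then have e: "A 0 = 0" "A 1 = 0" "A 2 = 0" "A 3 = B 0" "B 1 = 0" "B 2 = 0" "B 3 = 0"
      using lo[of 0] lo[of 1] lo[of 2] hi[of 0] hi[of 1] hi[of 2] hi[of 3] fA(6)[of 4] fA(6)[of 5]
        fA(6)[of 6] n
      by (simp_all add: eval_nat_numeral)
    then have "\<eta> = 1" "\<eta>' = 0" using fA(2,5) fB(5) by simp_all
    then have "\<exists>k::int. \<eta> = \<eta>' + k" by (auto intro: exI[of _ 1])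
    moreover have "\<xi> + 2 * \<eta> = c + \<xi>' + 2 * \<eta>'" using 4 e fA(2,4,5) fB(2,4,5) by simp
    ultimately show ?thesis by blast
  next
    case 5
    have "A j = 0" if "j < 4" for j using lo[of j] that 5 by simp
    with fA(2) have False by simp
    then show ?thesis ..
  qed blast
qed

lemma cell_points_eq_imp_torus_map_eq:
  fixes a b c :: nat and \<xi> \<eta> \<xi>' \<eta>' :: real
  assumes n: "n \<ge> 7" and r: "0 \<le> \<xi>" "\<xi> \<le> 1" "0 \<le> \<eta>" "\<eta> \<le> 1"
    and r': "0 \<le> \<xi>'" "\<xi>' \<le> 1" "0 \<le> \<eta>'" "\<eta>' \<le> 1"
    and eq: "cell_point n a \<xi> \<eta> = cell_point n b \<xi>' \<eta>'"
    and b: "b mod n = (a + c) mod n" and c: "c + 3 < n"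
  shows "torus_map n (a + \<xi>, \<eta>) = torus_map n (b + \<xi>', \<eta>')"
proof -
  from cell_points_eq_imp[OF n r r' eq b] c
  have 1: "\<exists>k::int. \<eta> = \<eta>' + k" and 2: "\<xi> + 2 * \<eta> = c + \<xi>' + 2 * \<eta>'" by auto
  have "int (a + c) mod int n = int b mod int n" using b by (metis zmod_int)
  then have "int n dvd int (a + c) - int b" by (simp add: mod_eq_dvd_iff)
  then obtain l where l: "int (a + c) - int b = int n * l" by blast
  then have "real_of_int (int (a + c) - int b) = real_of_int (int n * l)" by (rule arg_cong)
  with 2 have "a + \<xi> + 2 * \<eta> = b + \<xi>' + 2 * \<eta>' + of_int l * n" by (simp add: algebra_simps)
  with 1 n show ?thesis by (subst torus_map_eq_iff) auto
qed

lemma cell_point_top: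
  fixes \<xi> :: real
  assumes "0 \<le> \<xi>" "\<xi> \<le> 1"
  shows "cell_point n a \<xi> 1 = cell_point n (a + 2) \<xi> 0"
  using assms by (simp add: cell_point_def cell_weight_def fun_eq_iff eval_nat_numeral max_def min_def)

lemma integer_part_unique:
  fixes \<xi> \<xi>' :: real and i j :: int
  assumes "i + \<xi> = j + \<xi>'" "0 \<le> \<xi>" "\<xi> < 1" "0 \<le> \<xi>'" "\<xi>' < 1"
  shows "i = j" "\<xi> = \<xi>'"
proof -
  have "\<bar>real_of_int (i - j)\<bar> < 1" using assms by simp
  then show "i = j" by linarith
  with assms(1) show "\<xi> = \<xi>'" by simp
qed

text \<open>The carrier and the product of circles are quotients of the same strip, and the two maps
  identify the same points.\<close>
lemma cyclic_torus_homeomorphic: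
  assumes n: "n \<ge> 7"
  shows "geometric_carrier (complex_of (cyclic_torus n)) homeomorphic_space prod_topology circle circle"
proof -
  define Q where "Q = {0..real n} \<times> {0..1::real}"
  let ?X = "top_of_set Q"
  have compX: "compact_space ?X"
    unfolding Q_def compact_space_subtopology by (simp add: compact_space_subtopology compact_Times)
  have cell: "\<exists>a \<xi>. a \<le> n \<and> 0 \<le> \<xi> \<and> \<xi> < 1 \<and> x = real a + \<xi>" if "0 \<le> x" "x \<le> real n" for x
  proof (intro exI conjI)
    show "nat \<lfloor>x\<rfloor> \<le> n" using that by linarith
    show "x = real (nat \<lfloor>x\<rfloor>) + frac x" using that by (simp add: frac_def)
  qed (simp_all add: frac_lt_1)
  have set_torus: "t \<in> set (cyclic_torus n) \<longleftrightarrow> (\<exists>a<n. t = [a, (a + 1) mod n, (a + 3) mod n] \<or>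
      t = [a, (a + 3) mod n, (a + 2) mod n])" for t
    by (auto simp: cyclic_torus_def)
  have P: "x \<in> points (complex_of (cyclic_torus n)) \<longleftrightarrow> (\<forall>v. 0 \<le> x v) \<and>
      (\<exists>t\<in>set (cyclic_torus n). \<forall>v. x v \<noteq> 0 \<longrightarrow> v \<in> set t) \<and> sum x {..<n} = 1" for x
    by (rule points_complex_of_iff) (use n in \<open>auto simp: set_torus\<close>)
  have sum4: "(\<Sum>c<4. h c) = h 0 + h 1 + h 2 + h 3" for h :: "nat \<Rightarrow> real"
    by (simp add: eval_nat_numeral)
  have into: "cell_point n a \<xi> \<eta> \<in> points (complex_of (cyclic_torus n))"
    if "0 \<le> \<xi>" "\<xi> \<le> 1" "0 \<le> \<eta>" "\<eta> \<le> 1" for a \<xi> \<eta>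
  proof -
    note f = cell_weight_facts[OF that]
    have "\<forall>v. 0 \<le> cell_point n a \<xi> \<eta> v" unfolding cell_point_def by (intro allI sum_nonneg) (simp add: f(1))
    moreover have "sum (cell_point n a \<xi> \<eta>) {..<n} = 1"
    proof -
      have "sum (cell_point n a \<xi> \<eta>) {..<n} = (\<Sum>c<4. \<Sum>k<n. cell_weight \<xi> \<eta> c * of_bool (k = (a + c) mod n))"
        unfolding cell_point_def by (rule sum.swap)
      also have "\<dots> = (\<Sum>c<4. cell_weight \<xi> \<eta> c)"
        using n by (intro sum.cong refl) (simp add: sum_distrib_left[symmetric] of_bool_def)
      finally show ?thesis using f(2) by (simp add: sum4)
    qed
    moreover have "\<exists>t\<in>set (cyclic_torus n). \<forall>v. cell_point n a \<xi> \<eta> v \<noteq> 0 \<longrightarrow> v \<in> set t"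
    proof -
      have m: "(a mod n + c) mod n = (a + c) mod n" for c by (simp add: mod_simps)
      have an: "a mod n < n" using n by simp
      have t: "[a mod n, (a + 1) mod n, (a + 3) mod n] \<in> set (cyclic_torus n)"
        "[a mod n, (a + 3) mod n, (a + 2) mod n] \<in> set (cyclic_torus n)"
        unfolding set_torus m[symmetric] using an by blast+
      from f(3) show ?thesis
      proof
        assume w: "cell_weight \<xi> \<eta> 1 = 0"
        have "cell_point n a \<xi> \<eta> v = 0" if "v \<notin> set [a mod n, (a + 3) mod n, (a + 2) mod n]" for v
          using that w by (simp add: cell_point_def sum4)
        then show ?thesis using t(2) by blast
      next
        assume w: "cell_weight \<xi> \<eta> 2 = 0"
        have "cell_point n a \<xi> \<eta> v = 0" if "v \<notin> set [a mod n, (a + 1) mod n, (a + 3) mod n]" for v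
          using that w by (simp add: cell_point_def sum4)
        then show ?thesis using t(1) by blast
      qed
    qed
    ultimately show ?thesis by (simp add: P)
  qed
  have surj: "\<exists>a \<xi> \<eta>. a < n \<and> 0 \<le> \<xi> \<and> \<xi> \<le> 1 \<and> 0 \<le> \<eta> \<and> \<eta> \<le> 1 \<and> x = cell_point n a \<xi> \<eta>"
    if x: "x \<in> points (complex_of (cyclic_torus n))" for x
  proof -
    from x have nn: "\<And>v. 0 \<le> x v" and sx: "sum x {..<n} = 1" unfolding P by blast+
    from x obtain t where t: "t \<in> set (cyclic_torus n)" "\<forall>v. x v \<noteq> 0 \<longrightarrow> v \<in> set t"
      unfolding P by blast
    from t(1) obtain a where a: "a < n"
      and "t = [a, (a + 1) mod n, (a + 3) mod n] \<or> t = [a, (a + 3) mod n, (a + 2) mod n]"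
      unfolding set_torus by blast
    then have "set t = {a, (a + 1) mod n, (a + 3) mod n} \<or> set t = {a, (a + 2) mod n, (a + 3) mod n}"
      by (elim disjE) (simp_all add: insert_commute)
    \<comment> \<open>\<open>a + b\<close> is the middle corner of the triangle that contains the point\<close>
    then obtain b where b: "b = 1 \<or> b = (2::nat)" and tab: "set t = {a, (a + b) mod n, (a + 3) mod n}"
      by blast
    have supp: "x v = 0" if "v \<notin> {a, (a + b) mod n, (a + 3) mod n}" for v
      using t(2) that unfolding tab by blast
    define v0 v1 v2 where v: "v0 = a" "v1 = (a + b) mod n" "v2 = (a + 3) mod n"
    have a0: "a = (a + 0) mod n" using a by simp
    have dist: "v0 \<noteq> v1" "v0 \<noteq> v2" "v1 \<noteq> v2"
      using add_mod_eq_iff[of 0 n b a] add_mod_eq_iff[of 0 n 3 a] add_mod_eq_iff[of b n 3 a] n b a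
      by (auto simp: v)
    have "sum x {..<n} = sum x {v0, v1, v2}"
      by (rule sum.mono_neutral_right) (use a n supp in \<open>simp_all add: v\<close>)
    then have s1: "x v0 + x v1 + x v2 = 1" using dist sx by simp
    define \<xi> where "\<xi> = (if b = 1 then x v1 + x v2 else x v2)"
    define \<eta> where "\<eta> = (if b = 1 then x v2 else x v1 + x v2)"
    have W: "cell_weight \<xi> \<eta> 0 = x v0" "cell_weight \<xi> \<eta> b = x v1" "cell_weight \<xi> \<eta> 3 = x v2"
      "cell_weight \<xi> \<eta> (3 - b) = 0"
      using b s1 nn[of v0] nn[of v1] nn[of v2]
      by (auto simp: cell_weight_def \<xi>_def \<eta>_def max_def min_def)
    have "x k = cell_point n a \<xi> \<eta> k" for k
    proof -
      have "cell_point n a \<xi> \<eta> k = x v0 * of_bool (k = v0) + x v1 * of_bool (k = v1) + x v2 * of_bool (k = v2)"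
        using b W a by (auto simp: cell_point_def sum4 v)
      then show ?thesis using supp[of k, folded v] dist by auto
    qed
    moreover have "0 \<le> \<xi>" "\<xi> \<le> 1" "0 \<le> \<eta>" "\<eta> \<le> 1"
      using s1 nn[of v0] nn[of v1] nn[of v2] by (auto simp: \<xi>_def \<eta>_def)
    ultimately show ?thesis using a by blast
  qed
  have strip: "quotient_map ?X (geometric_carrier (complex_of (cyclic_torus n))) (strip_map n)"
  proof (rule continuous_imp_quotient_map[OF _ compX])
    show "Hausdorff_space (geometric_carrier (complex_of (cyclic_torus n)))"
      by (rule Hausdorff_geometric_carrier)
    have "continuous_on Q (strip_map n)"
    proof (rule continuous_on_coordinatewise_then_product)
      show "continuous_on Q (\<lambda>z. strip_map n z k)" for k
        unfolding strip_map_def lattice_hat_def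
        by (cases "k < n") (auto intro!: continuous_intros)
    qed
    moreover have im: "strip_map n ` Q = points (complex_of (cyclic_torus n))"
    proof (intro equalityI subsetI)
      fix x assume "x \<in> strip_map n ` Q"
      then obtain u y where uy: "0 \<le> u" "u \<le> real n" "0 \<le> y" "y \<le> 1" "x = strip_map n (u, y)"
        by (auto simp: Q_def)
      from cell[OF uy(1,2)] obtain a \<xi> where "a \<le> n" "0 \<le> \<xi>" "\<xi> < 1" "u = real a + \<xi>" by blast
      with uy show "x \<in> points (complex_of (cyclic_torus n))"
        by (simp add: strip_map_cell[OF n] into)
    next
      fix x assume "x \<in> points (complex_of (cyclic_torus n))"
      from surj[OF this] obtain a \<xi> \<eta> where *: "a < n" "0 \<le> \<xi>" "\<xi> \<le> 1" "0 \<le> \<eta>" "\<eta> \<le> 1"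
        "x = cell_point n a \<xi> \<eta>" by blast
      then have "x = strip_map n (a + \<xi>, \<eta>)" by (simp add: strip_map_cell[OF n])
      moreover have "(a + \<xi>, \<eta>) \<in> Q" using * by (auto simp: Q_def)
      ultimately show "x \<in> strip_map n ` Q" by blast
    qed
    ultimately show "continuous_map ?X (geometric_carrier (complex_of (cyclic_torus n))) (strip_map n)"
      unfolding geometric_carrier_points by auto
    show "strip_map n ` topspace ?X = topspace (geometric_carrier (complex_of (cyclic_torus n)))"
      by (simp add: geometric_carrier_points im)
  qed
  have torus: "quotient_map ?X (prod_topology circle circle) (torus_map n)"
  proof (rule continuous_imp_quotient_map[OF _ compX])
    show "Hausdorff_space (prod_topology circle circle)"
      by (simp add: Hausdorff_space_prod_topology Hausdorff_space_subtopology)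
    have "continuous_map ?X circle (\<lambda>z. cis (f z))" if "continuous_on Q f" for f
      using that by (auto intro!: continuous_intros)
    then show "continuous_map ?X (prod_topology circle circle) (torus_map n)"
      unfolding torus_map_def continuous_map_pairwise o_def fst_conv snd_conv
      using n by (intro conjI) (auto intro!: continuous_intros)
    have "(c, d) \<in> torus_map n ` Q" if "norm c = 1" "norm d = 1" for c d
    proof -
      obtain s t where st: "c = cis (2 * pi * s)" "d = cis (2 * pi * t)"
      proof -
        have "\<exists>s. c = cis (2 * pi * s)" if "norm c = 1" for c
        proof -
          have "c \<noteq> 0" using that by auto
          then have "c = cis (Arg c)" using that by (simp add: cis_Arg sgn_div_norm)
          then have "c = cis (2 * pi * (Arg c / (2 * pi)))" by simp
          then show ?thesis by blast
        qed
        with that \<open>norm c = 1\<close> \<open>norm d = 1\<close> show thesis by metis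
      qed
      define y where "y = frac t"
      define u where "u = n * frac (s - 2 * y / n)"
      have "(u, y) \<in> Q"
        using n mult_left_le[of "frac (s - 2 * y / n)" "real n"]
        by (auto simp: Q_def u_def y_def frac_lt_1 less_imp_le)
      moreover have "torus_map n (u, y) = (c, d)"
        unfolding torus_map_def st prod.inject cis_eq_iff
      proof (intro conjI exI)
        show "snd (u, y) = t + of_int (- \<lfloor>t\<rfloor>)" by (simp add: y_def frac_def)
        show "(fst (u, y) + 2 * snd (u, y)) / real n = s + of_int (- \<lfloor>s - 2 * y / n\<rfloor>)"
          using n by (simp add: u_def frac_def field_simps)
      qed
      ultimately show ?thesis by (metis image_eqI)
    qed
    then show "torus_map n ` topspace ?X = topspace (prod_topology circle circle)"
      by (auto simp: torus_map_def)
  qed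
  have fibres: "strip_map n z = strip_map n z' \<longleftrightarrow> torus_map n z = torus_map n z'"
    if zQ: "z \<in> Q" and z'Q: "z' \<in> Q" for z z'
  proof -
    obtain x y where z: "z = (x, y)" "0 \<le> x" "x \<le> real n" "0 \<le> y" "y \<le> 1"
      using zQ by (auto simp: Q_def)
    obtain x' y' where z': "z' = (x', y')" "0 \<le> x'" "x' \<le> real n" "0 \<le> y'" "y' \<le> 1"
      using z'Q by (auto simp: Q_def)
    obtain a \<xi> where a: "a \<le> n" "0 \<le> \<xi>" "\<xi> < 1" "x = real a + \<xi>" using cell[OF z(2,3)] by blast
    obtain b \<xi>' where b: "b \<le> n" "0 \<le> \<xi>'" "\<xi>' < 1" "x' = real b + \<xi>'" using cell[OF z'(2,3)] by blast
    have Fz: "strip_map n z = cell_point n a \<xi> y" "strip_map n z' = cell_point n b \<xi>' y'"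
      using z z' a b by (simp_all add: strip_map_cell[OF n])
    have Gz: "torus_map n z = torus_map n z' \<longleftrightarrow>
      (\<exists>k::int. y = y' + k) \<and> (\<exists>k::int. x + 2 * y = x' + 2 * y' + k * n)"
      unfolding z(1) z'(1) using n by (intro torus_map_eq_iff) simp
    show ?thesis
    proof
      assume *: "strip_map n z = strip_map n z'"
      \<comment> \<open>the distance between the two squares, counted in one direction or the other\<close>
      define c where "c = (b + n - a) mod n"
      have c: "c < n" using n by (simp add: c_def)
      have "(a + c) mod n = (a + (b + n - a)) mod n" by (simp add: c_def mod_add_right_eq)
      then have ab: "b mod n = (a + c) mod n" using a(1) by simp
      have eq: "cell_point n a \<xi> y = cell_point n b \<xi>' y'" using * Fz by simp
      show "torus_map n z = torus_map n z'"
      proof (cases "c + 3 < n")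
        case True
        show ?thesis unfolding z(1) z'(1) a(4) b(4)
          by (rule cell_points_eq_imp_torus_map_eq[OF n _ _ _ _ _ _ _ _ eq ab True])
            (use a b z z' in auto)
      next
        case False
        have "(b + (n - c)) mod n = (b mod n + (n - c)) mod n" by (simp add: mod_add_left_eq)
        also have "\<dots> = (a + c + (n - c)) mod n" unfolding ab by (simp only: mod_add_left_eq)
        also have "\<dots> = a mod n" using c by simp
        finally have ba: "a mod n = (b + (n - c)) mod n" ..
        have c': "(n - c) + 3 < n" using False n c by linarith
        have "torus_map n (b + \<xi>', y') = torus_map n (a + \<xi>, y)"
          by (rule cell_points_eq_imp_torus_map_eq[OF n _ _ _ _ _ _ _ _ eq[symmetric] ba c'])
            (use a b z z' in auto)
        then show ?thesis unfolding z(1) z'(1) a(4) b(4) ..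
      qed
    next
      assume "torus_map n z = torus_map n z'"
      then obtain k l :: int where kl: "y = y' + k" "x + 2 * y = x' + 2 * y' + l * n"
        unfolding Gz by blast
      \<comment> \<open>a step \<open>k\<close> from one row to the other moves the vertices by 2\<close>
      have "real_of_int (int a + 2 * k) + \<xi> = real_of_int (int b + l * int n) + \<xi>'"
        using kl a b by (simp add: algebra_simps)
      note e = integer_part_unique[OF this a(2,3) b(2,3)]
      have "(int a + 2 * k) mod int n = int b mod int n" unfolding e(1) by simp
      moreover have "\<bar>real_of_int k\<bar> \<le> 1" using kl(1) z(4,5) z'(4,5) by linarith
      then have "k = 0 \<or> k = 1 \<or> k = -1" by linarith
      ultimately consider "y = y'" "int a mod int n = int b mod int n"
        | "y = 1" "y' = 0" "int (a + 2) mod int n = int b mod int n"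
        | "y = 0" "y' = 1" "(int a - 2) mod int n = int b mod int n"
      proof (elim disjE)
        assume k: "k = 0" "(int a + 2 * k) mod int n = int b mod int n"
        then show thesis using kl(1) that(1) by simp
      next
        assume k: "k = 1" "(int a + 2 * k) mod int n = int b mod int n"
        then have "y = 1" "y' = 0" using kl(1) z(4,5) z'(4,5) by simp_all
        then show thesis using k that(2) by (simp add: ac_simps)
      next
        assume k: "k = -1" "(int a + 2 * k) mod int n = int b mod int n"
        then have "y = 0" "y' = 1" using kl(1) z(4,5) z'(4,5) by simp_all
        then show thesis using k that(3) by simp
      qed
      then show "strip_map n z = strip_map n z'"
      proof cases
        case 1
        then have "a mod n = b mod n" by (metis zmod_int nat_int)
        with 1 e(2) show ?thesis unfolding Fz by (metis cell_point_shift)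
      next
        case 2
        then have "(a + 2) mod n = b mod n" by (metis zmod_int nat_int)
        with 2 e(2) a show ?thesis
          unfolding Fz by (metis cell_point_shift cell_point_top less_imp_le)
      next
        case 3
        then have "int a mod int n = int (b + 2) mod int n"
          by (metis diff_add_cancel mod_add_left_eq of_nat_add of_nat_numeral)
        then have "a mod n = (b + 2) mod n" by (metis zmod_int nat_int)
        with 3 e(2) b show ?thesis
          unfolding Fz by (metis cell_point_shift cell_point_top less_imp_le)
      qed
    qed
  qed
  show ?thesis
    using quotients_homeomorphic[OF strip torus] fibres by simp
qed

section \<open>Cycles given by oriented triangles\<close>

definition alternating :: "('v list \<Rightarrow> int) \<Rightarrow> bool" where
  "alternating c \<longleftrightarrow> (\<forall>vs \<pi>. \<pi> permutes {..<length vs} \<longrightarrow> c (permute_list \<pi> vs) = sign \<pi> * c vs)"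

text \<open>Transpositions generate the symmetric group.\<close>
lemma alternatingI:
  assumes "\<And>vs i j. i < length vs \<Longrightarrow> j < length vs \<Longrightarrow> i \<noteq> j \<Longrightarrow>
     c (permute_list (Transposition.transpose i j) vs) = - c vs"
  shows "alternating c"
  unfolding alternating_def
proof (intro allI impI)
  fix vs :: "'a list" and \<pi> assume "\<pi> permutes {..<length vs}"
  with finite_lessThan show "c (permute_list \<pi> vs) = sign \<pi> * c vs"
  proof (induction rule: permutes_rev_induct)
    case id
    then show ?case by simp
  next
    case (swap a b p)
    have t: "Transposition.transpose a b permutes {..<length vs}"
      using swap by (intro permutes_swap_id)
    have "sign (p \<circ> Transposition.transpose a b) = sign p * sign (Transposition.transpose a b)"
      using swap t by (intro sign_compose) (auto simp: permutation_permutes)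
    then have "sign (p \<circ> Transposition.transpose a b) = - sign p"
      using swap by (simp add: sign_swap_id)
    moreover have "c (permute_list (Transposition.transpose a b) (permute_list p vs)) = - c (permute_list p vs)"
      using swap by (intro assms) simp_all
    ultimately show ?case
      using swap unfolding permute_list_compose[OF t] by (simp only: mult_minus_left)
  qed
qed

text \<open>The elementary chain of an ordered triangle. If two of \<open>a\<close>, \<open>b\<close>, \<open>c\<close> coincide, the six terms
  cancel, so that \<open>oriented_triangle (map f t)\<close> is the image of the chain under \<open>f\<close> even when \<open>f\<close>
  collapses the triangle.\<close>
fun oriented_triangle :: "'v list \<Rightarrow> 'v list \<Rightarrow> int" where
  "oriented_triangle [a, b, c] vs =
     of_bool (vs = [a, b, c]) + of_bool (vs = [b, c, a]) + of_bool (vs = [c, a, b])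
     - of_bool (vs = [b, a, c]) - of_bool (vs = [a, c, b]) - of_bool (vs = [c, b, a])"
| "oriented_triangle _ vs = 0"

lemma length_3_cases:
  assumes "length t = 3" obtains a b c where "t = [a, b, c]"
  using assms by (auto simp: length_Suc_conv eval_nat_numeral)

lemma oriented_triangle_nonzero:
  assumes "oriented_triangle t vs \<noteq> 0"
  shows "length vs = 3" "distinct vs" "set vs = set t" "length t = 3"
proof -
  show "length t = 3" using assms by (induction t vs rule: oriented_triangle.induct) auto
  then obtain a b c where t: "t = [a, b, c]" by (rule length_3_cases)
  have "vs \<in> {[a, b, c], [b, c, a], [c, a, b], [b, a, c], [a, c, b], [c, b, a]}"
    by (rule ccontr) (use assms in \<open>simp add: t\<close>)
  moreover have "distinct t"
    by (rule ccontr) (use assms in \<open>auto simp: t\<close>)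
  ultimately show "length vs = 3" "distinct vs" "set vs = set t"
    by (auto simp: t)
qed

lemma oriented_triangle_values:
  assumes "length t = 3" "distinct t" "length vs = 3" "set vs = set t"
  shows "oriented_triangle t vs = 1 \<or> oriented_triangle t vs = -1"
proof -
  obtain a b c where t: "t = [a, b, c]" using assms(1) by (rule length_3_cases)
  obtain x y z where vs: "vs = [x, y, z]" using assms(3) by (rule length_3_cases)
  have "card (set vs) = length vs" using assms by (metis distinct_card)
  then have "distinct vs" by (rule card_distinct)
  moreover have "x \<in> set t" "y \<in> set t" "z \<in> set t"
    unfolding assms(4)[symmetric] by (simp_all add: vs)
  then have "x = a \<or> x = b \<or> x = c" "y = a \<or> y = b \<or> y = c" "z = a \<or> z = b \<or> z = c"
    unfolding t by simp_all
  ultimately show ?thesis using assms(2) unfolding t vs by (elim disjE) simp_all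
qed

lemma alternating_oriented_triangle: "alternating (oriented_triangle t)"
proof (rule alternatingI)
  fix vs :: "'a list" and i j assume ij: "i < length vs" "j < length vs" "i \<noteq> j"
  show "oriented_triangle t (permute_list (Transposition.transpose i j) vs) = - oriented_triangle t vs"
  proof (cases "length t = 3 \<and> length vs = 3")
    case True
    obtain a b c where t: "t = [a, b, c]" using True by (auto elim: length_3_cases)
    obtain x y z where vs: "vs = [x, y, z]" using True by (auto elim: length_3_cases)
    have "i = 0 \<or> i = 1 \<or> i = 2" "j = 0 \<or> j = 1 \<or> j = 2"
      using ij unfolding vs by auto
    then have "permute_list (Transposition.transpose i j) vs \<in> {[y, x, z], [z, y, x], [x, z, y]}"
      using ij(3) unfolding vs
      by (elim disjE) (simp_all add: permute_list_def upt_rec Transposition.transpose_def)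
    then consider "permute_list (Transposition.transpose i j) vs = [y, x, z]"
      | "permute_list (Transposition.transpose i j) vs = [z, y, x]"
      | "permute_list (Transposition.transpose i j) vs = [x, z, y]" by blast
    then show ?thesis unfolding t vs by cases (simp_all add: conj_ac)
  next
    case False
    have "oriented_triangle t us = 0" if "length us = length vs" for us
      using False oriented_triangle_nonzero(1,4)[of t us] that by metis
    then show ?thesis by simp
  qed
qed

lemma alternating_add: "alternating c \<Longrightarrow> alternating d \<Longrightarrow> alternating (\<lambda>vs. c vs + d vs)"
  by (simp add: alternating_def distrib_left)

lemma alternating_uminus: "alternating c \<Longrightarrow> alternating (\<lambda>vs. - c vs)"
  by (simp add: alternating_def)

lemma alternating_0: "alternating (\<lambda>vs. 0)"
  by (simp add: alternating_def)

definition oriented_sum :: "'v list list \<Rightarrow> 'v list \<Rightarrow> int" where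
  "oriented_sum ts vs = (\<Sum>t\<leftarrow>ts. oriented_triangle t vs)"

lemma oriented_sum_simps [simp]:
  "oriented_sum [] vs = 0"
  "oriented_sum (t # ts) vs = oriented_triangle t vs + oriented_sum ts vs"
  by (simp_all add: oriented_sum_def)

lemma alternating_oriented_sum: "alternating (oriented_sum ts)"
proof (induction ts)
  case Nil then show ?case by (simp add: alternating_def)
next
  case (Cons t ts)
  then show ?case
    using alternating_add[OF alternating_oriented_triangle[of t] Cons] by (simp add: alternating_def)
qed

lemma oriented_sum_nonzeroE:
  assumes "oriented_sum ts vs \<noteq> 0"
  obtains t where "t \<in> set ts" "oriented_triangle t vs \<noteq> 0"
proof -
  have "\<exists>t\<in>set ts. oriented_triangle t vs \<noteq> 0"
    using assms by (induction ts) (simp, metis add_0 list.set_intros oriented_sum_simps(2))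
  with that show thesis by blast
qed

lemma oriented_sum_nonzero:
  assumes "oriented_sum ts vs \<noteq> 0"
  shows "length vs = 3" "distinct vs" "set vs \<in> complex_of ts"
proof -
  obtain t where t: "t \<in> set ts" "oriented_triangle t vs \<noteq> 0"
    using assms by (rule oriented_sum_nonzeroE)
  note * = oriented_triangle_nonzero[OF t(2)]
  then show "length vs = 3" "distinct vs" by simp_all
  then show "set vs \<in> complex_of ts" using t(1) * by (auto simp: complex_of_def)
qed

lemma oriented_sum_chain: "oriented_sum ts \<in> simplicial_chains 2 (complex_of ts)"
  using alternating_oriented_sum[of ts] oriented_sum_nonzero[of ts]
  unfolding simplicial_chains_def alternating_def by (auto simp: eval_nat_numeral)

text \<open>The boundary of the oriented triangle, each edge in the induced direction.\<close>
fun directed_edges :: "'v list \<Rightarrow> 'v list list" where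
  "directed_edges [a, b, c] = [[b, c], [c, a], [a, b]]"
| "directed_edges _ = []"

lemma sum_of_bool_Cons:
  assumes "finite U" "a \<in> U"
  shows "(\<Sum>v\<in>U. of_bool (v # ws = a # bs)) = (of_bool (ws = bs) :: int)"
proof -
  have "(\<Sum>v\<in>U. of_bool (v # ws = a # bs)) = (\<Sum>v\<in>U. if v = a then of_bool (ws = bs) else (0::int))"
    by (intro sum.cong) auto
  with assms show ?thesis by simp
qed

lemma sum_oriented_triangle:
  assumes U: "finite U" "set t \<subseteq> U"
  shows "(\<Sum>v\<in>U. oriented_triangle t (v # ws)) =
     (\<Sum>e\<leftarrow>directed_edges t. of_bool (ws = e) - of_bool (ws = rev e))"
proof (cases "length t = 3")
  case True
  then obtain a b c where t: "t = [a, b, c]" by (rule length_3_cases)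
  have m: "a \<in> U" "b \<in> U" "c \<in> U" using U(2) t by auto
  show ?thesis
    unfolding t oriented_triangle.simps sum.distrib sum_subtractf
      sum_of_bool_Cons[OF U(1) m(1)] sum_of_bool_Cons[OF U(1) m(2)] sum_of_bool_Cons[OF U(1) m(3)]
    by simp
next
  case False
  then show ?thesis by (induction t ws rule: oriented_triangle.induct) auto
qed

lemma sum_oriented_sum:
  assumes U: "finite U" "\<Union>(set ` set ts) \<subseteq> U"
    and E: "mset (map rev (concat (map directed_edges ts))) = mset (concat (map directed_edges ts))"
  shows "(\<Sum>v\<in>U. oriented_sum ts (v # ws)) = 0"
proof -
  let ?E = "concat (map directed_edges ts)"
  have s: "(\<Sum>e\<leftarrow>es. h e) = sum_mset (image_mset h (mset es))" for h :: "'a list \<Rightarrow> int" and es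
    by (simp flip: sum_mset_sum_list)
  have "(\<Sum>v\<in>U. oriented_sum ts (v # ws)) = (\<Sum>e\<leftarrow>?E. of_bool (ws = e) - of_bool (ws = rev e))"
    using U(2) by (induction ts) (simp_all add: sum.distrib sum_oriented_triangle[OF U(1)])
  also have "\<dots> = (\<Sum>e\<leftarrow>?E. of_bool (ws = e)) - (\<Sum>e\<leftarrow>map rev ?E. of_bool (ws = e))"
    by (simp add: sum_list_subtractf o_def)
  also have "(\<Sum>e\<leftarrow>map rev ?E. of_bool (ws = e)) = (\<Sum>e\<leftarrow>?E. of_bool (ws = e) :: int)"
    unfolding s E ..
  finally show ?thesis by simp
qed

text \<open>The last conjunct says that every directed edge occurs as often as its reverse, so that the
  boundary cancels. It is a statement about multisets because these are carried along by any map of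
  the vertices.\<close>
definition closed_oriented :: "'v list list \<Rightarrow> bool" where
  "closed_oriented ts \<longleftrightarrow> (\<forall>t\<in>set ts. length t = 3 \<and> distinct t) \<and> distinct (map set ts) \<and>
     mset (map rev (concat (map directed_edges ts))) = mset (concat (map directed_edges ts))"

lemma closed_oriented_simplices:
  assumes "closed_oriented ts"
  shows "t \<in> set ts \<Longrightarrow> set t \<in> complex_of ts" and "\<sigma> \<in> complex_of ts \<Longrightarrow> card \<sigma> \<le> 3"
proof -
  have 3: "length t = 3" if "t \<in> set ts" for t
    using assms that unfolding closed_oriented_def by blast
  show "set t \<in> complex_of ts" if "t \<in> set ts"
    using 3[OF that] that by (auto simp: complex_of_def)
  assume "\<sigma> \<in> complex_of ts"
  then obtain t where t: "t \<in> set ts" "\<sigma> \<subseteq> set t" by (auto simp: complex_of_def)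
  then have "card \<sigma> \<le> card (set t)" by (intro card_mono) simp_all
  also have "\<dots> \<le> 3" using 3[OF t(1)] card_length[of t] by simp
  finally show "card \<sigma> \<le> 3" .
qed

lemma oriented_sum_eq_oriented_triangle:
  assumes "distinct (map set ts)" "t \<in> set ts" "set vs = set t"
  shows "oriented_sum ts vs = oriented_triangle t vs"
proof -
  have 0: "oriented_sum us vs = 0" if "set t \<notin> set ` set us" for us
  proof -
    have "\<forall>u\<in>set us. oriented_triangle u vs = 0"
      using that assms(3) oriented_triangle_nonzero(3)[of _ vs] by (metis image_eqI)
    then show ?thesis by (induction us) simp_all
  qed
  show ?thesis
    using assms(1,2)
  proof (induction ts)
    case (Cons u us)
    show ?case
    proof (cases "u = t")
      case True
      with Cons 0[of us] show ?thesis by simp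
    next
      case False
      with Cons have "t \<in> set us" by simp
      with Cons have "set u \<noteq> set t" by (metis distinct.simps(2) image_eqI list.set_map list.simps(9))
      then have "oriented_triangle u vs = 0" using assms(3) oriented_triangle_nonzero(3)[of u vs] by metis
      with Cons \<open>t \<in> set us\<close> show ?thesis by simp
    qed
  qed simp
qed

lemma surface_orientation_oriented_sum:
  assumes ts: "closed_oriented ts"
  shows "surface_orientation (complex_of ts) (oriented_sum ts)"
  unfolding surface_orientation_def simplicial_cycles_def
proof (intro conjI CollectI allI impI)
  show "oriented_sum ts \<in> simplicial_chains 2 (complex_of ts)" by (rule oriented_sum_chain)
  have "(\<Sum>v\<in>vertices (complex_of ts). oriented_sum ts (v # ws)) = 0" for ws
    using ts unfolding vertices_complex_of closed_oriented_def by (intro sum_oriented_sum) auto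
  then show "simplicial_boundary (complex_of ts) (oriented_sum ts) = (\<lambda>_. 0)"
    by (simp add: simplicial_boundary_def fun_eq_iff)
  fix vs assume vs: "length vs = 3 \<and> distinct vs \<and> set vs \<in> complex_of ts"
  then obtain t where t: "t \<in> set ts" "set vs \<subseteq> set t" by (auto simp: complex_of_def)
  have t3: "length t = 3" "distinct t" using ts t by (auto simp: closed_oriented_def)
  then have "set vs = set t"
    using vs t by (intro card_subset_eq) (simp_all add: distinct_card)
  with oriented_triangle_values[OF t3, of vs] oriented_sum_eq_oriented_triangle[of ts t vs] ts t vs
  show "oriented_sum ts vs = 1 \<or> oriented_sum ts vs = - 1" by (simp add: closed_oriented_def)
qed

lemma closed_oriented_rename:
  assumes ts: "closed_oriented ts" and inj: "inj_on \<rho> (\<Union>(set ` set ts))"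
  shows "closed_oriented (map (map \<rho>) ts)"
  unfolding closed_oriented_def
proof (intro conjI)
  show "\<forall>t\<in>set (map (map \<rho>) ts). length t = 3 \<and> distinct t"
    using ts by (auto simp: closed_oriented_def distinct_map intro: inj_on_subset[OF inj])
  have "distinct (map ((`) \<rho>) (map set ts))"
    using ts inj unfolding distinct_map[of _ "map set ts"] closed_oriented_def
    by (auto intro!: inj_onI dest: inj_on_image_eq_iff[THEN iffD1, rotated 3])
  then show "distinct (map set (map (map \<rho>) ts))" by (simp add: o_def)
  have d: "directed_edges (map \<rho> t) = map (map \<rho>) (directed_edges t)" for t
    by (induction t rule: directed_edges.induct) auto
  have e: "concat (map directed_edges (map (map \<rho>) ts)) = map (map \<rho>) (concat (map directed_edges ts))"
    by (simp add: d map_concat o_def)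
  have r: "map rev (map (map \<rho>) es) = map (map \<rho>) (map rev es)" for es :: "'a list list"
    by (simp add: rev_map)
  show "mset (map rev (concat (map directed_edges (map (map \<rho>) ts)))) =
      mset (concat (map directed_edges (map (map \<rho>) ts)))"
    unfolding e r mset_map[of "map \<rho>"] using ts by (simp add: closed_oriented_def)
qed

lemma finite_simplex_lists:
  assumes "abstract_complex K"
  shows "finite {vs. set vs \<in> K \<and> map f vs = ws}"
proof (rule finite_subset)
  show "finite {vs. set vs \<subseteq> vertices K \<and> length vs = length ws}"
    by (rule finite_lists_length_eq) (rule abstract_complex_finite(2)[OF assms])
qed auto

lemma pushforward_mono:
  assumes "abstract_complex J" "K \<subseteq> J" "\<And>vs. c vs \<noteq> 0 \<Longrightarrow> set vs \<in> K"
  shows "simplicial_pushforward J f c = simplicial_pushforward K f c"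
  unfolding simplicial_pushforward_def fun_eq_iff
  using finite_simplex_lists[OF assms(1)] assms(2,3)
  by (intro allI sum.mono_neutral_right) auto

lemma pushforward_add:
  "simplicial_pushforward K f (\<lambda>vs. c vs + d vs) ws =
     simplicial_pushforward K f c ws + simplicial_pushforward K f d ws"
  by (simp add: simplicial_pushforward_def sum.distrib)

lemma pushforward_uminus:
  "simplicial_pushforward K f (\<lambda>vs. - c vs) ws = - simplicial_pushforward K f c ws"
  by (simp add: simplicial_pushforward_def sum_negf)

lemma pushforward_cong:
  assumes "\<And>v. v \<in> vertices K \<Longrightarrow> f v = g v"
  shows "simplicial_pushforward K f c = simplicial_pushforward K g c"
proof -
  have "{vs. set vs \<in> K \<and> map f vs = ws} = {vs. set vs \<in> K \<and> map g vs = ws}" for ws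
  proof -
    have "map f vs = map g vs" if "set vs \<in> K" for vs using that assms by (intro map_cong) auto
    then show ?thesis by auto
  qed
  then show ?thesis by (simp add: simplicial_pushforward_def fun_eq_iff)
qed

lemma pushforward_oriented_triangle:
  assumes K: "abstract_complex K" and t: "set t \<in> K"
  shows "simplicial_pushforward K f (oriented_triangle t) ws = oriented_triangle (map f t) ws"
proof (cases "length t = 3")
  case True
  then obtain a b c where abc: "t = [a, b, c]" by (rule length_3_cases)
  have s: "(\<Sum>vs | set vs \<in> K \<and> map f vs = ws. of_bool (vs = us)) = (of_bool (ws = map f us) :: int)"
    if "set us = set t" for us
    using finite_simplex_lists[OF K, of f ws] that t by (auto simp: of_bool_def)
  show ?thesis
    unfolding simplicial_pushforward_def abc oriented_triangle.simps sum.distrib sum_subtractf list.map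
    by (subst s, force simp: abc)+ simp
next
  case False
  then have "oriented_triangle t vs = 0" "oriented_triangle (map f t) ws = 0" for vs
    using oriented_triangle_nonzero(4)[of t vs] oriented_triangle_nonzero(4)[of "map f t" ws] by auto
  then show ?thesis by (simp add: simplicial_pushforward_def)
qed

lemma pushforward_oriented_sum:
  assumes K: "abstract_complex K" and t: "\<And>t. t \<in> set ts \<Longrightarrow> set t \<in> K"
  shows "simplicial_pushforward K f (oriented_sum ts) ws = oriented_sum (map (map f) ts) ws"
  using t
proof (induction ts)
  case Nil
  then show ?case by (simp add: simplicial_pushforward_def)
next
  case (Cons t ts)
  then show ?case
    using pushforward_oriented_triangle[OF K, of t f ws]
    by (simp add: pushforward_add)
qed

text \<open>Conditions that rewriting decides for a concrete list.\<close>
lemma closed_orientedI: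
  fixes ts :: "'v :: linorder list list"
  assumes "list_all (\<lambda>t. length t = 3 \<and> distinct t) ts" and "distinct (map sort ts)"
    and E: "distinct (concat (map directed_edges ts))"
      "list_all (\<lambda>e. rev e \<in> set (concat (map directed_edges ts))) (concat (map directed_edges ts))"
  shows "closed_oriented ts"
  unfolding closed_oriented_def
proof (intro conjI)
  show 3: "\<forall>t\<in>set ts. length t = 3 \<and> distinct t" using assms(1) by (simp add: list_all_iff)
  have "inj_on (\<lambda>t. sorted_list_of_set (set t)) (set ts)"
  proof -
    have "inj_on sort (set ts)" "distinct ts" using assms(2) by (simp_all add: distinct_map)
    moreover have "sort t = sorted_list_of_set (set t)" if "t \<in> set ts" for t
      using 3 that by (simp add: sorted_list_of_set_sort_remdups distinct_remdups_id)
    ultimately show ?thesis by (simp cong: inj_on_cong)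
  qed
  then have "inj_on set (set ts)" by (auto simp: inj_on_def)
  with assms(2) show "distinct (map set ts)" by (simp add: distinct_map)
  let ?E = "concat (map directed_edges ts)"
  have "set (map rev ?E) \<subseteq> set ?E" using E(2) by (auto simp: list_all_iff)
  moreover have "distinct (map rev ?E)" using E(1) by (simp add: distinct_map)
  then have "card (set (map rev ?E)) = card (set ?E)"
    using distinct_card[of "map rev ?E"] distinct_card[OF E(1)] by simp
  ultimately have "set (map rev ?E) = set ?E" by (intro card_subset_eq) simp_all
  with \<open>distinct (map rev ?E)\<close> E(1) show "mset (map rev ?E) = mset ?E"
    by (simp only: set_eq_iff_mset_eq_distinct)
qed

lemma closed_oriented_torus7: "closed_oriented torus7_triangles"
  by (rule closed_orientedI) (simp_all add: torus7_triangles_def)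

lemma torus7_orientation_eq: "torus7_orientation = oriented_sum torus7_triangles"
proof
  fix vs
  let ?T = "torus7_triangles"
  have T: "t \<in> set ?T \<Longrightarrow> length t = 3 \<and> distinct t" "distinct (map set ?T)" for t
    using closed_oriented_torus7 unfolding closed_oriented_def by blast+
  have rot: "rotate n us = us \<or> rotate n us = rotate1 us \<or> rotate n us = rotate1 (rotate1 us)"
    if "length us = 3" for n and us :: "nat list"
  proof -
    have "n mod 3 = 0 \<or> n mod 3 = 1 \<or> n mod 3 = 2" by linarith
    moreover have "rotate n us = rotate (n mod 3) us" unfolding that[symmetric] by (rule rotate_conv_mod)
    ultimately show ?thesis by (elim disjE) (simp_all only: rotate_def funpow.simps numeral_2_eq_2 One_nat_def o_apply id_apply simp_thms)
  qed
  show "torus7_orientation vs = oriented_sum ?T vs"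
  proof (cases "oriented_sum ?T vs = 0")
    case True
    have "rotate n vs \<notin> set ?T \<and> rotate n (rev vs) \<notin> set ?T" for n
    proof -
      have "us \<notin> set ?T" if "set us = set vs" "length us = length vs" for us
      proof
        assume us: "us \<in> set ?T"
        have "oriented_triangle us vs = 1 \<or> oriented_triangle us vs = -1"
          by (rule oriented_triangle_values) (use T(1)[OF us] that in simp_all)
        then have "oriented_triangle us vs \<noteq> 0" by auto
        then show False using oriented_sum_eq_oriented_triangle[OF T(2) us, of vs] that True by simp
      qed
      then show ?thesis by simp
    qed
    with True show ?thesis by (simp add: torus7_orientation_def)
  next
    case False
    then obtain t where t: "t \<in> set ?T" "oriented_triangle t vs \<noteq> 0"
      by (rule oriented_sum_nonzeroE)
    have eq: "oriented_sum ?T vs = oriented_triangle t vs"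
      using oriented_sum_eq_oriented_triangle[OF T(2) t(1)] oriented_triangle_nonzero(3)[OF t(2)] by simp
    obtain a b c where abc: "t = [a, b, c]" using T(1)[OF t(1)] by (auto elim: length_3_cases)
    have d: "distinct [a, b, c]" using T(1)[OF t(1)] abc by simp
    have "vs \<in> {[a, b, c], [b, c, a], [c, a, b]} \<or> vs \<in> {[b, a, c], [a, c, b], [c, b, a]}"
      by (rule ccontr) (use t(2) in \<open>simp add: abc\<close>)
    then show ?thesis
    proof
      assume vs: "vs \<in> {[a, b, c], [b, c, a], [c, a, b]}"
      then have "rotate 0 vs = t \<or> rotate 2 vs = t \<or> rotate 1 vs = t"
        by (auto simp: abc eval_nat_numeral)
      then have "\<exists>n. rotate n vs \<in> set ?T" using t(1) by metis
      moreover have "oriented_triangle t vs = 1" using vs d by (auto simp: abc)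
      ultimately show ?thesis unfolding eq by (simp add: torus7_orientation_def)
    next
      assume vs: "vs \<in> {[b, a, c], [a, c, b], [c, b, a]}"
      then have "rotate 0 (rev vs) = t \<or> rotate 2 (rev vs) = t \<or> rotate 1 (rev vs) = t"
        by (auto simp: abc eval_nat_numeral)
      then have "\<exists>n. rotate n (rev vs) \<in> set ?T" using t(1) by metis
      moreover have "rotate n vs \<notin> set ?T" for n
      proof
        assume n: "rotate n vs \<in> set ?T"
        have "set (rotate n vs) = set t" using oriented_triangle_nonzero(3)[OF t(2)] by simp
        with T(2) n t(1) have "rotate n vs = t" by (auto simp: distinct_map inj_on_def)
        with rot[of vs n] vs d show False by (auto simp: abc)
      qed
      moreover have "oriented_triangle t vs = -1" using vs d by (auto simp: abc)
      ultimately show ?thesis unfolding eq by (simp add: torus7_orientation_def)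
    qed
  qed
qed

section \<open>The degree when there are no 3-simplices\<close>

lemma simplicial_cycles_iff:
  "c \<in> simplicial_cycles p K \<longleftrightarrow> (\<forall>vs. c vs \<noteq> 0 \<longrightarrow> length vs = Suc p \<and> distinct vs \<and> set vs \<in> K) \<and>
     alternating c \<and> (\<forall>ws. ws \<noteq> [] \<longrightarrow> (\<Sum>v\<in>vertices K. c (v # ws)) = 0)"
  by (auto simp: simplicial_cycles_def simplicial_chains_def alternating_def simplicial_boundary_def fun_eq_iff)

lemma simplicial_cycles_add:
  assumes "c \<in> simplicial_cycles p K" "d \<in> simplicial_cycles p K"
  shows "(\<lambda>vs. c vs + d vs) \<in> simplicial_cycles p K"
  unfolding simplicial_cycles_iff
proof (intro conjI allI impI)
  show "alternating (\<lambda>vs. c vs + d vs)" using assms by (simp add: simplicial_cycles_iff alternating_add)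
  show "(\<Sum>v\<in>vertices K. c (v # ws) + d (v # ws)) = 0" if "ws \<noteq> []" for ws
    using assms that by (simp add: simplicial_cycles_iff sum.distrib)
  fix vs assume "c vs + d vs \<noteq> 0"
  then have "c vs \<noteq> 0 \<or> d vs \<noteq> 0" by auto
  then show "length vs = Suc p" "distinct vs" "set vs \<in> K" using assms by (auto simp: simplicial_cycles_iff)
qed

lemma simplicial_cycles_uminus:
  "c \<in> simplicial_cycles p K \<Longrightarrow> (\<lambda>vs. - c vs) \<in> simplicial_cycles p K"
  by (simp add: simplicial_cycles_iff alternating_uminus sum_negf)

lemma simplicial_cycles_0: "(\<lambda>vs. 0) \<in> simplicial_cycles p K"
  by (simp add: simplicial_cycles_iff alternating_0)

lemma comm_group_simplicial_cycle_group: "comm_group (simplicial_cycle_group p K)"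
proof (rule comm_groupI)
  fix x assume "x \<in> carrier (simplicial_cycle_group p K)"
  then show "\<exists>y\<in>carrier (simplicial_cycle_group p K).
      y \<otimes>\<^bsub>simplicial_cycle_group p K\<^esub> x = \<one>\<^bsub>simplicial_cycle_group p K\<^esub>"
    by (intro bexI[of _ "\<lambda>vs. - x vs"]) (simp_all add: simplicial_cycle_group_def simplicial_cycles_uminus)
qed (auto simp: simplicial_cycle_group_def simplicial_cycles_0 simplicial_cycles_add fun_eq_iff)

lemma simplicial_cycle_group_int_pow:
  assumes "c \<in> simplicial_cycles p K"
  shows "c [^]\<^bsub>simplicial_cycle_group p K\<^esub> (d :: int) = (\<lambda>vs. d * c vs)"
proof -
  interpret G: comm_group "simplicial_cycle_group p K" by (rule comm_group_simplicial_cycle_group)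
  have c: "c \<in> carrier (simplicial_cycle_group p K)" using assms by (simp add: simplicial_cycle_group_def)
  have n: "c [^]\<^bsub>simplicial_cycle_group p K\<^esub> (n :: nat) = (\<lambda>vs. int n * c vs)" for n
  proof (induction n)
    case 0
    then show ?case by (simp add: simplicial_cycle_group_def)
  next
    case (Suc n)
    then show ?case by (simp add: simplicial_cycle_group_def distrib_right add.commute)
  qed
  show ?thesis
  proof (cases "d \<ge> 0")
    case True
    then obtain n where "d = int n" by (metis nonneg_int_cases)
    then show ?thesis by (simp add: int_pow_int n)
  next
    case False
    then obtain m where d: "d = - int m" by (metis int_cases neg_0_le_iff_le linorder_linear nonneg_int_cases minus_minus)
    have inv: "inv\<^bsub>simplicial_cycle_group p K\<^esub> (\<lambda>vs. int m * c vs) = (\<lambda>vs. - int m * c vs)"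
    proof (rule G.inv_equality)
      show m: "(\<lambda>vs. int m * c vs) \<in> carrier (simplicial_cycle_group p K)"
        using G.nat_pow_closed[OF c, of m] unfolding n .
      show "(\<lambda>vs. - int m * c vs) \<in> carrier (simplicial_cycle_group p K)"
        using simplicial_cycles_uminus[of "\<lambda>vs. int m * c vs" p K] m by (simp add: simplicial_cycle_group_def)
    qed (simp add: simplicial_cycle_group_def)
    show ?thesis unfolding d using inv by (simp add: G.int_pow_neg[OF c] int_pow_int n)
  qed
qed

text \<open>There are no simplices of dimension \<open>p + 1\<close> that could have a boundary.\<close>
lemma simplicial_boundaries_trivial:
  assumes "\<And>\<sigma>. \<sigma> \<in> K \<Longrightarrow> card \<sigma> \<le> Suc p"
  shows "simplicial_boundaries p K = {\<lambda>_. 0}"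
proof -
  have "simplicial_chains (Suc p) K = {\<lambda>_. 0}"
  proof (intro equalityI subsetI)
    fix c assume c: "c \<in> simplicial_chains (Suc p) K"
    have "c vs = 0" for vs
    proof (rule ccontr)
      assume "c vs \<noteq> 0"
      then have "length vs = Suc (Suc p)" "distinct vs" "set vs \<in> K"
        using c by (auto simp: simplicial_chains_def)
      then show False using assms[of "set vs"] by (simp add: distinct_card)
    qed
    then show "c \<in> {\<lambda>_. 0}" by auto
  qed (simp add: simplicial_chains_def)
  then show ?thesis by (simp add: simplicial_boundaries_def simplicial_boundary_def fun_eq_iff)
qed

text \<open>In dimension 2, homology classes of 2-cycles are single cycles, so the degree can be read off
  from the image of the fundamental cycle.\<close>
lemma has_simplicial_degreeI:
  assumes K: "\<And>\<sigma>. \<sigma> \<in> K \<Longrightarrow> card \<sigma> \<le> 3" and L: "\<And>\<sigma>. \<sigma> \<in> L \<Longrightarrow> card \<sigma> \<le> 3"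
    and \<omega>L: "\<omega>L \<in> simplicial_cycles 2 L"
    and push: "\<And>ws. simplicial_pushforward K f \<omega>K ws = d * \<omega>L ws"
  shows "has_simplicial_degree K \<omega>K L \<omega>L f d"
proof -
  let ?G = "simplicial_cycle_group 2 L"
  interpret G: comm_group ?G by (rule comm_group_simplicial_cycle_group)
  have BK: "simplicial_boundaries 2 K = {\<lambda>_. 0}" and BL: "simplicial_boundaries 2 L = {\<lambda>_. 0}"
    using K L by (auto intro!: simplicial_boundaries_trivial simp: eval_nat_numeral)
  have one: "{\<lambda>_. 0} = {\<one>\<^bsub>?G\<^esub>}" by (simp add: simplicial_cycle_group_def)
  have norm: "normal {\<one>\<^bsub>?G\<^esub>} ?G" by (rule G.one_is_normal)
  have cl: "\<omega>L \<in> carrier ?G" using \<omega>L by (simp add: simplicial_cycle_group_def)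
  have "fundamental_class L \<omega>L [^]\<^bsub>simplicial_homology_group 2 L\<^esub> d
      = {\<one>\<^bsub>?G\<^esub>} #>\<^bsub>?G\<^esub> (\<omega>L [^]\<^bsub>?G\<^esub> d)"
    unfolding simplicial_homology_class_def simplicial_homology_group_def BL one
    by (rule normal.FactGroup_int_pow[OF norm cl])
  also have "\<dots> = {\<lambda>vs. d * \<omega>L vs}"
    unfolding simplicial_cycle_group_int_pow[OF \<omega>L] one[symmetric]
    by (simp add: r_coset_def simplicial_cycle_group_def)
  also have "\<dots> = simplicial_hom_induced 2 K L f (fundamental_class K \<omega>K)"
    unfolding simplicial_hom_induced_def simplicial_homology_class_def BK BL
    by (simp add: r_coset_def set_mult_def simplicial_cycle_group_def push fun_eq_iff)
  finally show ?thesis by (simp add: has_simplicial_degree_def)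
qed

section \<open>Adding a handle\<close>

lemma simplicial_cycles_transfer:
  assumes c: "c \<in> simplicial_cycles p A" and B: "\<And>vs. c vs \<noteq> 0 \<Longrightarrow> set vs \<in> B"
    and fin: "finite (vertices A)" "finite (vertices B)"
  shows "c \<in> simplicial_cycles p B"
proof -
  have "(\<Sum>v\<in>vertices A. c (v # ws)) = (\<Sum>v\<in>vertices B. c (v # ws))" for ws
  proof (rule sum.mono_neutral_cong[OF fin(2,1)])
    show "c (v # ws) = 0" if "v \<in> vertices B - vertices A" for v
    proof (rule ccontr)
      assume "c (v # ws) \<noteq> 0"
      then have "set (v # ws) \<in> A" using c unfolding simplicial_cycles_iff by blast
      then have "v \<in> vertices A" by (rule UnionI) simp
      with that show False by blast
    qed
    show "c (v # ws) = 0" if "v \<in> vertices A - vertices B" for v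
      using that B[of "v # ws"] UnionI[of "set (v # ws)" B v] by fastforce
  qed simp
  then show ?thesis using c B by (simp add: simplicial_cycles_iff)
qed

lemma oriented_triangle_rename:
  assumes "inj_on \<rho> (set t \<union> set vs)"
  shows "oriented_triangle (map \<rho> t) (map \<rho> vs) = oriented_triangle t vs"
proof (cases "length t = 3")
  case True
  then obtain a b c where t: "t = [a, b, c]" by (rule length_3_cases)
  have "map \<rho> vs = map \<rho> us \<longleftrightarrow> vs = us" if "set us \<subseteq> set t" for us
    using assms that by (intro inj_on_map_eq_map) (auto intro: inj_on_subset)
  from this[of "[a, b, c]"] this[of "[b, c, a]"] this[of "[c, a, b]"]
    this[of "[b, a, c]"] this[of "[a, c, b]"] this[of "[c, b, a]"]
  show ?thesis by (simp add: t)
next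
  case False
  then show ?thesis
    using oriented_triangle_nonzero(4)[of t vs] oriented_triangle_nonzero(4)[of "map \<rho> t" "map \<rho> vs"]
    by (metis length_map)
qed

lemma oriented_sum_rename:
  assumes "inj_on \<rho> (\<Union>(set ` set ts) \<union> set vs)"
  shows "oriented_sum (map (map \<rho>) ts) (map \<rho> vs) = oriented_sum ts vs"
  using assms
proof (induction ts)
  case (Cons t ts)
  have "inj_on \<rho> (set t \<union> set vs)" "inj_on \<rho> (\<Union>(set ` set ts) \<union> set vs)"
    using Cons.prems by (auto elim!: inj_on_subset)
  with Cons.IH show ?case by (simp add: oriented_triangle_rename)
qed simp

text \<open>The edge \<open>rw\<close> lies in exactly the two triangles \<open>rwp\<close> and \<open>rwq\<close>. The prescribed images are the
  same at each step so that the maps agree where two surfaces are glued; the images 7, 4, 1, 3 of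
  \<open>p\<close>, \<open>q\<close>, \<open>r\<close>, \<open>w\<close> are those of \<open>-1\<close>, 3, 0, 2 under \<open>a \<mapsto> a + 1\<close> modulo 7.\<close>
definition marked_quad :: "nat set set \<Rightarrow> (nat \<Rightarrow> nat) \<Rightarrow> nat \<Rightarrow> nat \<Rightarrow> nat \<Rightarrow> nat \<Rightarrow> bool" where
  "marked_quad K f p q r w \<longleftrightarrow> distinct [p, q, r, w] \<and> {r, w, p} \<in> K \<and> {r, w, q} \<in> K \<and>
     (\<forall>\<sigma>\<in>K. {r, w} \<subseteq> \<sigma> \<longrightarrow> \<sigma> \<in> quad_interior p q r w) \<and> f p = 7 \<and> f q = 4 \<and> f r = 1 \<and> f w = 3"

definition marked_surface :: "nat \<Rightarrow> int \<Rightarrow> nat set set \<Rightarrow> (nat list \<Rightarrow> int) \<Rightarrow> (nat \<Rightarrow> nat) \<Rightarrow> bool" where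
  "marked_surface g d K \<omega> f \<longleftrightarrow>
     abstract_complex K \<and> closed_orientable_surface g (geometric_carrier K) \<and>
     (\<forall>\<sigma>\<in>K. card \<sigma> \<le> 3) \<and> surface_orientation K \<omega> \<and> simplicial_map K torus7 f \<and>
     (\<forall>ws. simplicial_pushforward K f \<omega> ws = d * torus7_orientation ws) \<and>
     (\<exists>p q r w. marked_quad K f p q r w \<and> \<omega> [r, w, p] = 1)"

text \<open>A torus that is glued in along the triangles \<open>rwp\<close> and \<open>rwq\<close>. It traverses them backwards, while
  the triangles \<open>rxp\<close> and \<open>rxq\<close> have the right orientation to serve as the disc of the next step.
  If \<open>pq\<close> were an edge, it could coincide with an edge of the other surface outside the disc.\<close>
definition torus_piece :: "int \<Rightarrow> nat list list \<Rightarrow> (nat \<Rightarrow> nat) \<Rightarrow> nat \<Rightarrow> nat \<Rightarrow> nat \<Rightarrow> nat \<Rightarrow> nat \<Rightarrow> bool" where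
  "torus_piece e ts h p q r w x \<longleftrightarrow>
     geometric_carrier (complex_of ts) homeomorphic_space prod_topology circle circle \<and>
     closed_oriented ts \<and> simplicial_map (complex_of ts) torus7 h \<and>
     (\<forall>ws. oriented_sum (map (map h) ts) ws = e * torus7_orientation ws) \<and>
     marked_quad (complex_of ts) h p q r w \<and> oriented_sum ts [r, w, p] = -1 \<and>
     marked_quad (complex_of ts) h p q r x \<and> oriented_sum ts [r, x, p] = 1 \<and> x \<noteq> w \<and>
     {p, q} \<notin> complex_of ts"

lemma alternating_opposite:
  assumes "alternating c" "alternating d" "c [x, y, z] + d [x, y, z] = 0"
    and "length vs = 3" "distinct vs" "set vs = {x, y, z}"
  shows "c vs + d vs = 0"
proof -
  have "card {x, y, z} = 3" using assms distinct_card[of vs] by simp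
  then have "distinct [x, y, z]" by (intro card_distinct) simp
  then have "mset vs = mset [x, y, z]"
    using assms(5,6) by (subst set_eq_iff_mset_eq_distinct[symmetric]) simp_all
  then obtain \<pi> where \<pi>: "\<pi> permutes {..<length [x, y, z]}" "permute_list \<pi> [x, y, z] = vs"
    by (rule mset_eq_permutation)
  then have "c vs + d vs = sign \<pi> * (c [x, y, z] + d [x, y, z])"
    using assms(1,2) unfolding alternating_def by (metis distrib_left)
  with assms(3) show ?thesis by simp
qed

lemma alternating_rotate:
  assumes "alternating c"
  shows "c [x, y, z] = c [y, z, x]"
proof -
  let ?s = "\<lambda>i j. Transposition.transpose i (j::nat)"
  have "c (permute_list (?s i j) us) = - c us" if "i < length us" "j < length us" "i \<noteq> j" for i j us
    using assms that unfolding alternating_def by (simp add: permutes_swap_id sign_swap_id)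
  from this[of 0 "[x, y, z]" 1] this[of 1 "[y, x, z]" 2]
  show ?thesis by (simp add: permute_list_def upt_rec Transposition.transpose_def)
qed

text \<open>The two triangles are the only ones that contribute to the boundary at the edge \<open>rw\<close>.\<close>
lemma quad_cancels:
  assumes c: "c \<in> simplicial_cycles 2 K" and d: "distinct [p, q, r, w]"
    and Kq: "\<forall>\<sigma>\<in>K. {r, w} \<subseteq> \<sigma> \<longrightarrow> \<sigma> \<in> quad_interior p q r w"
    and K: "{r, w, p} \<in> K" "{r, w, q} \<in> K" and fin: "finite (vertices K)"
  shows "c [r, w, q] = - c [r, w, p]"
proof -
  have a: "alternating c" using c by (simp add: simplicial_cycles_iff)
  have "(\<Sum>v\<in>vertices K. c (v # [r, w])) = (\<Sum>v\<in>{p, q}. c (v # [r, w]))"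
  proof (rule sum.mono_neutral_right[OF fin])
    show "{p, q} \<subseteq> vertices K" using UnionI[OF K(1), of p] UnionI[OF K(2), of q] by simp
    show "\<forall>v\<in>vertices K - {p, q}. c (v # [r, w]) = 0"
    proof (intro ballI, rule ccontr)
      fix v assume v: "v \<in> vertices K - {p, q}" "c (v # [r, w]) \<noteq> 0"
      then have "distinct [v, r, w]" "{v, r, w} \<in> K" using c by (auto simp: simplicial_cycles_iff)
      moreover from this Kq have "{v, r, w} \<in> quad_interior p q r w" by auto
      ultimately show False using v by (auto simp: quad_interior_def)
    qed
  qed
  then have "c [p, r, w] + c [q, r, w] = 0"
    using c d by (auto simp: simplicial_cycles_iff)
  then show ?thesis using alternating_rotate[OF a, of p r w] alternating_rotate[OF a, of q r w] by simp
qed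

text \<open>The torus is renamed so that it meets the surface in the disc only. The new complex is the union
  without the open disc, and its orientation is the sum of the two cycles, which cancel on the
  disc.\<close>
lemma glue_torus_piece:
  assumes S: "marked_surface g d K \<omega> f" and T: "torus_piece e ts h p' q' r' w' x'"
  obtains K' \<omega>' f' where "marked_surface (g + 1) (d + e) K' \<omega>' f'"
    "card (vertices K') + 4 = card (vertices K) + card (\<Union>(set ` set ts))"
proof -
  obtain p q r w where mq: "marked_quad K f p q r w" and \<omega>p: "\<omega> [r, w, p] = 1"
    and K: "abstract_complex K" and surf: "closed_orientable_surface g (geometric_carrier K)"
    and K3: "\<forall>\<sigma>\<in>K. card \<sigma> \<le> 3" and \<omega>: "surface_orientation K \<omega>" and f: "simplicial_map K torus7 f"
    and fd: "\<forall>ws. simplicial_pushforward K f \<omega> ws = d * torus7_orientation ws"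
    using S unfolding marked_surface_def by blast
  have d: "distinct [p, q, r, w]" and pK: "{r, w, p} \<in> K" and qK: "{r, w, q} \<in> K"
    and Kq: "\<forall>\<sigma>\<in>K. {r, w} \<subseteq> \<sigma> \<longrightarrow> \<sigma> \<in> quad_interior p q r w"
    and fl: "f p = 7" "f q = 4" "f r = 1" "f w = 3"
    using mq unfolding marked_quad_def by blast+
  let ?C = "complex_of ts"
  have T1: "geometric_carrier ?C homeomorphic_space prod_topology circle circle"
    and ts: "closed_oriented ts" and h: "simplicial_map ?C torus7 h"
    and he: "\<forall>ws. oriented_sum (map (map h) ts) ws = e * torus7_orientation ws"
    and mqw: "marked_quad ?C h p' q' r' w'" and tw: "oriented_sum ts [r', w', p'] = -1"
    and mqx: "marked_quad ?C h p' q' r' x'" and tx: "oriented_sum ts [r', x', p'] = 1"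
    and xw: "x' \<noteq> w'" and pq: "{p', q'} \<notin> ?C"
    using T unfolding torus_piece_def by blast+
  have d': "distinct [p', q', r', w']" "distinct [p', q', r', x']"
    and pC: "{r', w', p'} \<in> ?C" "{r', x', p'} \<in> ?C" and qC: "{r', w', q'} \<in> ?C" "{r', x', q'} \<in> ?C"
    and Cq: "\<forall>\<sigma>\<in>?C. {r', w'} \<subseteq> \<sigma> \<longrightarrow> \<sigma> \<in> quad_interior p' q' r' w'"
      "\<forall>\<sigma>\<in>?C. {r', x'} \<subseteq> \<sigma> \<longrightarrow> \<sigma> \<in> quad_interior p' q' r' x'"
    and hl: "h p' = 7" "h q' = 4" "h r' = 1" "h w' = 3" "h x' = 3"
    using mqw mqx unfolding marked_quad_def by blast+
  define V where "V = \<Union>(set ` set ts)"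
  have CV: "\<sigma> \<subseteq> V" if "\<sigma> \<in> ?C" for \<sigma> using that by (auto simp: V_def complex_of_def)
  have V: "finite V" "{p', q', r', w', x'} \<subseteq> V"
    using CV[OF pC(1)] CV[OF pC(2)] CV[OF qC(1)] by (simp_all add: V_def)
  note fK = abstract_complex_finite[OF K]
  obtain N where "\<forall>v\<in>vertices K. v < N"
    using fK(2) unfolding finite_nat_set_iff_bounded by blast
  then have N: "v < N" if "v \<in> vertices K" for v using that by blast
  \<comment> \<open>vertices outside the disc are shifted past those of \<open>K\<close>\<close>
  define \<rho> where "\<rho> v = (if v = p' then p else if v = q' then q else if v = r' then r
     else if v = w' then w else v + N)" for v
  have pqrw: "p \<in> vertices K" "q \<in> vertices K" "r \<in> vertices K" "w \<in> vertices K"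
    using UnionI[OF pK, of p] UnionI[OF qK, of q] UnionI[OF pK, of r] UnionI[OF pK, of w] by simp_all
  note less = N[OF pqrw(1)] N[OF pqrw(2)] N[OF pqrw(3)] N[OF pqrw(4)]
  have \<rho>s: "\<rho> p' = p" "\<rho> q' = q" "\<rho> r' = r" "\<rho> w' = w" using d' by (auto simp: \<rho>_def)
  have inj: "inj \<rho>"
  proof (rule injI)
    fix a b assume "\<rho> a = \<rho> b"
    have out: "\<rho> v = v + N" if "v \<notin> {p', q', r', w'}" for v using that by (simp add: \<rho>_def)
    have ins: "\<rho> v < N" if "v \<in> {p', q', r', w'}" for v using that less by (auto simp: \<rho>s)
    show "a = b"
    proof (cases "a \<in> {p', q', r', w'} \<and> b \<in> {p', q', r', w'}")
      case True
      have ne: "p \<noteq> q" "p \<noteq> r" "p \<noteq> w" "q \<noteq> r" "q \<noteq> w" "r \<noteq> w" using d by simp_all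
      from True have "a = p' \<or> a = q' \<or> a = r' \<or> a = w'" "b = p' \<or> b = q' \<or> b = r' \<or> b = w'"
        by simp_all
      then show ?thesis
        using \<open>\<rho> a = \<rho> b\<close> by (elim disjE) (simp_all add: \<rho>s ne ne[symmetric])
    next
      case False
      then show ?thesis using \<open>\<rho> a = \<rho> b\<close> ins[of a] ins[of b] out[of a] out[of b] by linarith
    qed
  qed
  have \<rho>K: "\<rho> v \<in> vertices K \<longleftrightarrow> v \<in> {p', q', r', w'}" for v
  proof (cases "v \<in> {p', q', r', w'}")
    case False
    then have "\<rho> v = v + N" by (simp add: \<rho>_def)
    then have "\<rho> v \<notin> vertices K" using N[of "\<rho> v"] by linarith
    with False show ?thesis by blast
  next
    case True
    then have "\<rho> v \<in> {p, q, r, w}" by (auto simp: \<rho>s)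
    with True pqrw show ?thesis by blast
  qed
  define x where "x = \<rho> x'"
  have xK: "x \<notin> vertices K" unfolding x_def \<rho>K using d' xw by auto
  \<comment> \<open>on the disc, the two maps agree by the prescribed images\<close>
  define f' where "f' v = (if v \<in> vertices K then f v else h (v - N))" for v
  have f'\<rho>: "f' (\<rho> v) = h v" for v
  proof (cases "v \<in> {p', q', r', w'}")
    case True
    then have "f' (\<rho> v) = f (\<rho> v)" unfolding f'_def using \<rho>K by simp
    with True fl hl show ?thesis by (auto simp: \<rho>s)
  next
    case False
    then have "f' (\<rho> v) = h (\<rho> v - N)" unfolding f'_def using \<rho>K by simp
    with False show ?thesis by (simp add: \<rho>_def)
  qed
  have f'K: "f' v = f v" if "v \<in> vertices K" for v using that by (simp add: f'_def)

  define us where "us = map (map \<rho>) ts"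
  let ?T = "complex_of us"
  let ?S = "quad_interior p q r w"
  let ?J = "K \<union> ?T - ?S"
  define \<tau> where "\<tau> = oriented_sum us"
  have T: "abstract_complex ?T" by (rule abstract_complex_complex_of)
  have memT: "\<sigma> \<in> ?T \<longleftrightarrow> (\<exists>\<sigma>0\<in>?C. \<sigma> = \<rho> ` \<sigma>0)" for \<sigma>
  proof
    assume "\<sigma> \<in> ?T"
    then obtain t where t: "t \<in> set ts" "\<sigma> \<noteq> {}" "\<sigma> \<subseteq> \<rho> ` set t" by (auto simp: complex_of_def us_def)
    then obtain \<sigma>0 where "\<sigma>0 \<subseteq> set t" "\<sigma> = \<rho> ` \<sigma>0" by (auto simp: subset_image_iff)
    with t show "\<exists>\<sigma>0\<in>?C. \<sigma> = \<rho> ` \<sigma>0" by (auto simp: complex_of_def)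
  next
    assume "\<exists>\<sigma>0\<in>?C. \<sigma> = \<rho> ` \<sigma>0"
    then show "\<sigma> \<in> ?T" by (force simp: complex_of_def us_def)
  qed
  have verT: "vertices ?T = \<rho> ` V" unfolding vertices_complex_of by (auto simp: us_def V_def)
  have pT: "{r, w, p} \<in> ?T" "{r, w, q} \<in> ?T" "{r, x, p} \<in> ?T" "{r, x, q} \<in> ?T"
  proof -
    have "\<rho> ` \<sigma>0 \<in> ?T" if "\<sigma>0 \<in> ?C" for \<sigma>0 using memT that by blast
    from this[OF pC(1)] this[OF qC(1)] this[OF pC(2)] this[OF qC(2)]
    show "{r, w, p} \<in> ?T" "{r, w, q} \<in> ?T" "{r, x, p} \<in> ?T" "{r, x, q} \<in> ?T"
      by (simp_all add: \<rho>s x_def[symmetric])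
  qed
  have quadsub: "quad p q r w \<subseteq> J" if "abstract_complex J" "{r, w, p} \<in> J" "{r, w, q} \<in> J" for J
    using abstract_complexD(4)[OF that(1)] that(2,3) by (auto simp: quad_def complex_of_def)
  have meet: "K \<inter> ?T = quad p q r w"
  proof
    show "quad p q r w \<subseteq> K \<inter> ?T" using quadsub[OF K pK qK] quadsub[OF T pT(1,2)] by blast
    show "K \<inter> ?T \<subseteq> quad p q r w"
    proof
      fix \<sigma> assume \<sigma>: "\<sigma> \<in> K \<inter> ?T"
      then obtain \<sigma>0 where \<sigma>0: "\<sigma>0 \<in> ?C" "\<sigma> = \<rho> ` \<sigma>0" using memT by blast
      have "\<sigma>0 \<subseteq> {p', q', r', w'}"
      proof
        fix v assume "v \<in> \<sigma>0"
        then have "\<rho> v \<in> vertices K" using \<sigma> \<sigma>0 by (intro UnionI[of \<sigma>]) auto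
        then show "v \<in> {p', q', r', w'}" by (simp only: \<rho>K)
      qed
      moreover have "\<not> {p', q'} \<subseteq> \<sigma>0"
        using pq abstract_complexD(4)[OF abstract_complex_complex_of \<sigma>0(1), of "{p', q'}"] by auto
      ultimately have "\<sigma>0 \<subseteq> {r', w', p'} \<or> \<sigma>0 \<subseteq> {r', w', q'}" by (cases "p' \<in> \<sigma>0") auto
      then have "\<sigma> \<subseteq> \<rho> ` {r', w', p'} \<or> \<sigma> \<subseteq> \<rho> ` {r', w', q'}"
        unfolding \<sigma>0(2) by (elim disjE) (simp_all only: image_mono simp_thms)
      then have "\<sigma> \<subseteq> {r, w, p} \<or> \<sigma> \<subseteq> {r, w, q}" by (simp add: \<rho>s)
      moreover have "\<sigma> \<noteq> {}" using \<sigma> abstract_complexD(3)[OF K] by blast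
      ultimately show "\<sigma> \<in> quad p q r w" by (simp add: quad_def complex_of_def)
    qed
  qed
  have starT: "\<sigma> \<in> quad_interior p q r (\<rho> y)"
    if star: "\<forall>\<sigma>\<in>?C. {r', y} \<subseteq> \<sigma> \<longrightarrow> \<sigma> \<in> quad_interior p' q' r' y"
      and sT: "\<sigma> \<in> ?T" and ry: "{r, \<rho> y} \<subseteq> \<sigma>" for \<sigma> y
  proof -
    obtain \<sigma>0 where \<sigma>0: "\<sigma>0 \<in> ?C" "\<sigma> = \<rho> ` \<sigma>0" using sT memT by blast
    have "{r', y} \<subseteq> \<sigma>0"
    proof -
      have "\<rho> r' \<in> \<rho> ` \<sigma>0" "\<rho> y \<in> \<rho> ` \<sigma>0" using ry by (simp_all add: \<sigma>0(2)[symmetric] \<rho>s)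
      then show ?thesis by (simp add: inj_image_mem_iff[OF inj])
    qed
    then have "\<sigma>0 \<in> quad_interior p' q' r' y" by (rule star[rule_format, OF \<sigma>0(1)])
    then show ?thesis unfolding \<sigma>0(2) quad_interior_def by (elim insertE emptyE) (simp_all add: \<rho>s)
  qed
  have Tq: "\<sigma> \<in> ?S" if "\<sigma> \<in> ?T" "{r, w} \<subseteq> \<sigma>" for \<sigma>
    by (rule starT[OF Cq(1), unfolded \<rho>s, OF that])
  then have Tq': "\<forall>\<sigma>\<in>?T. {r, w} \<subseteq> \<sigma> \<longrightarrow> \<sigma> \<in> ?S" by blast
  note sum = connected_sum_along_quad[OF K T meet d Kq[rule_format] Tq]
  have J: "abstract_complex ?J" by (rule sum(1))
  have "geometric_carrier ?T homeomorphic_space geometric_carrier ?C"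
    unfolding us_def
    by (subst homeomorphic_space_sym) (rule rename_homeomorphic, rule inj_on_subset[OF inj], simp)
  then have "closed_orientable_surface 1 (geometric_carrier ?T)"
    using T1 by (intro closed_orientable_surface.torus) (rule homeomorphic_space_trans)
  then have surfJ: "closed_orientable_surface (g + 1) (geometric_carrier ?J)"
    by (rule closed_orientable_surface.sum[OF surf _ sum(2)])

  have us: "closed_oriented us"
    unfolding us_def by (rule closed_oriented_rename[OF ts inj_on_subset[OF inj]]) simp
  note \<tau> = surface_orientation_oriented_sum[OF us, folded \<tau>_def]
  have \<tau>v: "\<tau> [\<rho> a, \<rho> b, \<rho> c] = oriented_sum ts [a, b, c]" for a b c
    using oriented_sum_rename[OF inj_on_subset[OF inj], of ts "[a, b, c]"] by (simp add: \<tau>_def us_def)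
  have \<tau>p: "\<tau> [r, w, p] = -1" using \<tau>v[of r' w' p'] tw by (simp add: \<rho>s)
  have c\<omega>: "\<omega> \<in> simplicial_cycles 2 K" and c\<tau>: "\<tau> \<in> simplicial_cycles 2 ?T"
    using \<omega> \<tau> by (simp_all add: surface_orientation_def)
  note supp\<omega> = c\<omega>[unfolded simplicial_cycles_iff, THEN conjunct1, rule_format]
  note supp\<tau> = c\<tau>[unfolded simplicial_cycles_iff, THEN conjunct1, rule_format]
  have alt: "alternating \<omega>" "alternating \<tau>" using c\<omega> c\<tau> by (simp_all add: simplicial_cycles_iff)
  define \<omega>' where "\<omega>' = (\<lambda>vs. \<omega> vs + \<tau> vs)"
  \<comment> \<open>the two cycles have opposite signs on the disc\<close>
  have cancel: "\<omega>' vs = 0" if "set vs \<in> ?S" for vs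
  proof (rule ccontr)
    assume nz: "\<omega>' vs \<noteq> 0"
    then have "\<omega> vs \<noteq> 0 \<or> \<tau> vs \<noteq> 0" unfolding \<omega>'_def by linarith
    then have "length vs = Suc 2 \<and> distinct vs" using supp\<omega>[of vs] supp\<tau>[of vs] by blast
    then have vs: "length vs = 3" "distinct vs" by simp_all
    have q: "\<omega> [r, w, q] + \<tau> [r, w, q] = 0"
      using quad_cancels[OF c\<omega> d Kq pK qK fK(2)]
        quad_cancels[OF c\<tau> d Tq' pT(1,2) abstract_complex_finite(2)[OF T]] \<omega>p \<tau>p by simp
    have "card (set vs) = 3" using vs by (simp add: distinct_card)
    moreover have "card {r, w} = 2" using d by simp
    ultimately have "set vs \<noteq> {r, w}" by (metis numeral_eq_iff semiring_norm(88))
    with that have "set vs = {r, w, p} \<or> set vs = {r, w, q}" unfolding quad_interior_def by blast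
    then have "\<omega> vs + \<tau> vs = 0"
      using alternating_opposite[OF alt _ vs, of r w p] alternating_opposite[OF alt q vs] \<omega>p \<tau>p
      by (elim disjE) simp_all
    with nz show False by (simp add: \<omega>'_def)
  qed
  have supp': "set vs \<in> ?J" if "\<omega>' vs \<noteq> 0" for vs
  proof -
    have "\<omega> vs \<noteq> 0 \<or> \<tau> vs \<noteq> 0" using that unfolding \<omega>'_def by linarith
    then have "set vs \<in> K \<union> ?T" using supp\<omega>[of vs] supp\<tau>[of vs] by blast
    moreover have "set vs \<notin> ?S" using cancel[of vs] that by blast
    ultimately show ?thesis by blast
  qed
  have finU: "finite (vertices (K \<union> ?T))" using fK(2) abstract_complex_finite(2)[OF T] by simp
  have "\<omega> \<in> simplicial_cycles 2 (K \<union> ?T)" "\<tau> \<in> simplicial_cycles 2 (K \<union> ?T)"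
    using simplicial_cycles_transfer[OF c\<omega> _ fK(2) finU] supp\<omega>
      simplicial_cycles_transfer[OF c\<tau> _ abstract_complex_finite(2)[OF T] finU] supp\<tau> by auto
  then have "\<omega>' \<in> simplicial_cycles 2 (K \<union> ?T)" unfolding \<omega>'_def by (rule simplicial_cycles_add)
  then have c\<omega>': "\<omega>' \<in> simplicial_cycles 2 ?J"
    by (rule simplicial_cycles_transfer[OF _ supp' finU abstract_complex_finite(2)[OF J]])
  have \<omega>': "surface_orientation ?J \<omega>'"
    unfolding surface_orientation_def
  proof (intro conjI c\<omega>' allI impI)
    fix vs assume vs: "length vs = 3 \<and> distinct vs \<and> set vs \<in> ?J"
    have "\<not> (set vs \<in> K \<and> set vs \<in> ?T)"
    proof
      assume "set vs \<in> K \<and> set vs \<in> ?T"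
      then have "set vs \<in> quad p q r w" using meet by blast
      then obtain y where y: "y = p \<or> y = q" "set vs \<subseteq> {r, w, y}" by (auto simp: quad_def complex_of_def)
      have "card {r, w, y} \<le> card (set vs)" using vs by (simp add: distinct_card card_insert_if)
      then have "set vs = {r, w, y}" using y(2) by (intro card_seteq) auto
      then show False using vs y(1) by (auto simp: quad_interior_def)
    qed
    then have "(set vs \<in> K \<and> \<tau> vs = 0) \<or> (set vs \<in> ?T \<and> \<omega> vs = 0)"
      using vs supp\<omega>[of vs] supp\<tau>[of vs] by blast
    then show "\<omega>' vs = 1 \<or> \<omega>' vs = - 1"
      using \<omega> \<tau> vs by (auto simp: \<omega>'_def surface_orientation_def)
  qed

  have f': "simplicial_map ?J torus7 f'"
    unfolding simplicial_map_def
  proof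
    fix \<sigma> assume "\<sigma> \<in> ?J"
    then consider "\<sigma> \<in> K" | "\<sigma> \<in> ?T" by blast
    then show "f' ` \<sigma> \<in> torus7"
    proof cases
      case 1
      then have "f' ` \<sigma> = f ` \<sigma>" using f'K by (intro image_cong) auto
      with 1 f show ?thesis by (simp add: simplicial_map_def)
    next
      case 2
      then obtain \<sigma>0 where "\<sigma>0 \<in> ?C" "\<sigma> = \<rho> ` \<sigma>0" using memT by blast
      with h show ?thesis by (simp add: simplicial_map_def image_image f'\<rho>)
    qed
  qed
  note KT = abstract_complex_Un[OF K T]
  have push: "simplicial_pushforward ?J f' \<omega>' ws = (d + e) * torus7_orientation ws" for ws
  proof -
    \<comment> \<open>the open disc can be put back because the new cycle vanishes on it\<close>
    have "simplicial_pushforward ?J f' \<omega>' = simplicial_pushforward (K \<union> ?T) f' \<omega>'"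
      by (rule pushforward_mono[OF KT _ supp', symmetric]) auto
    moreover have "simplicial_pushforward (K \<union> ?T) f' \<omega> = simplicial_pushforward K f' \<omega>"
      by (rule pushforward_mono[OF KT]) (use supp\<omega> in auto)
    moreover have "simplicial_pushforward K f' \<omega> = simplicial_pushforward K f \<omega>"
      by (rule pushforward_cong) (rule f'K)
    moreover have "simplicial_pushforward (K \<union> ?T) f' \<tau> = simplicial_pushforward ?T f' \<tau>"
      by (rule pushforward_mono[OF KT]) (use supp\<tau> in auto)
    moreover have "simplicial_pushforward ?T f' \<tau> ws = oriented_sum (map (map f') us) ws"
      unfolding \<tau>_def
      by (rule pushforward_oriented_sum[OF T closed_oriented_simplices(1)[OF us]])
    moreover have "map (map f') us = map (map h) ts"
      by (simp add: us_def f'\<rho> o_def)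
    ultimately show ?thesis using fd he by (simp add: \<omega>'_def pushforward_add distrib_right)
  qed
  have J3: "card \<sigma> \<le> 3" if "\<sigma> \<in> ?J" for \<sigma>
    using that K3 closed_oriented_simplices(2)[OF us] by blast

  have S3: "\<not> {r, x} \<subseteq> \<sigma>" if "\<sigma> \<in> ?S" for \<sigma> using that xK pqrw by (auto simp: quad_interior_def)
  have dx: "distinct [p, q, r, x]" using d xK pqrw by auto
  have "marked_quad ?J f' p q r x"
    unfolding marked_quad_def
  proof (intro conjI dx ballI impI)
    show "{r, x, p} \<in> ?J" "{r, x, q} \<in> ?J" using pT(3,4) S3 by blast+
    show "\<sigma> \<in> quad_interior p q r x" if "\<sigma> \<in> ?J" "{r, x} \<subseteq> \<sigma>" for \<sigma>
    proof -
      have "\<sigma> \<in> ?T" using that xK by auto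
      then show ?thesis using starT[OF Cq(2)] that by (simp add: x_def)
    qed
  qed (use f'K pqrw fl f'\<rho>[of x'] hl in \<open>simp_all add: x_def\<close>)
  moreover have "\<omega>' [r, x, p] = 1"
  proof -
    have "{r, x, p} \<notin> K" using UnionI[of "{r, x, p}" K x] xK by blast
    then have "\<omega> [r, x, p] = 0" using supp\<omega>[of "[r, x, p]"] by auto
    then show ?thesis using \<tau>v[of r' x' p'] tx by (simp add: \<omega>'_def \<rho>s x_def)
  qed
  ultimately have "marked_surface (g + 1) (d + e) ?J \<omega>' f'"
    unfolding marked_surface_def using J surfJ J3 \<omega>' f' push by blast
  moreover have "card (vertices ?J) + 4 = card (vertices K) + card V"
  proof -
    have "vertices ?J = vertices K \<union> \<rho> ` V"
    proof
      show "vertices K \<union> \<rho> ` V \<subseteq> vertices ?J"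
      proof
        fix v assume "v \<in> vertices K \<union> \<rho> ` V"
        then have "v \<in> vertices (K \<union> ?T)" using verT by auto
        then have "{v} \<in> K \<union> ?T" using abstract_complexD(4)[OF KT, of _ "{v}"] by blast
        moreover have "{v} \<notin> ?S" using d by (auto simp: quad_interior_def)
        ultimately show "v \<in> vertices ?J" by blast
      qed
    qed (use verT in auto)
    moreover have "vertices K \<inter> \<rho> ` V = \<rho> ` {p', q', r', w'}"
    proof (intro equalityI subsetI IntI)
      fix u assume "u \<in> vertices K \<inter> \<rho> ` V"
      then obtain v where v: "u = \<rho> v" "\<rho> v \<in> vertices K" by blast
      show "u \<in> \<rho> ` {p', q', r', w'}" unfolding v(1) by (rule imageI) (use v(2) in \<open>simp only: \<rho>K\<close>)
    next
      fix u assume "u \<in> \<rho> ` {p', q', r', w'}"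
      then obtain v where v: "u = \<rho> v" "v \<in> {p', q', r', w'}" by blast
      show "u \<in> vertices K" unfolding v(1) \<rho>K by (rule v(2))
      show "u \<in> \<rho> ` V" unfolding v(1) by (rule imageI) (use v(2) V(2) in blast)
    qed
    moreover have "card (\<rho> ` V) = card V" "card (\<rho> ` {p', q', r', w'}) = 4"
      using d' by (subst card_image[OF inj_on_subset[OF inj]]; simp)+
    ultimately show ?thesis
      using card_Un_Int[OF fK(2) finite_imageI[OF V(1), of \<rho>]] by simp
  qed
  ultimately show thesis using that by (simp add: V_def)
qed

section \<open>The two torus pieces\<close>

text \<open>The path is \<open>-1 - 0 - 3\<close> with the neighbour 2 of all its vertices. Vertex 7 separates the ends 6
  and 3 of the path. Vertices 8 and 9 on the edge from 0 to 2 stand for the vertices \<open>r\<close> and \<open>w\<close> of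
  the surface to which the torus is added: 9 becomes a neighbour of 0 and 8 a neighbour of 2,
  which is the crosswise gluing.\<close>
definition single_piece :: "nat list list" where
  "single_piece = subdivide_edge 0 8 9 (subdivide_edge 0 2 8 (subdivide_edge 3 6 7 (cyclic_torus 7)))"

definition single_label :: "nat \<Rightarrow> nat" where
  "single_label v = (if v = 7 then 4 else if v = 8 then 1 else if v = 9 then 3 else v mod 7 + 1)"

text \<open>As before, with 14 and 15 in place of 8 and 9; the ends 13 and 3 of the path are not
  adjacent in the 14-vertex torus.\<close>
definition double_piece :: "nat list list" where
  "double_piece = subdivide_edge 0 14 15 (subdivide_edge 0 2 14 (cyclic_torus 14))"

definition double_label :: "nat \<Rightarrow> nat" where
  "double_label v = (if v = 14 then 1 else if v = 15 then 3 else v mod 7 + 1)"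

lemma cyclic_torus_7:
  "cyclic_torus 7 =
   [[0,1,3], [0,3,2], [1,2,4], [1,4,3], [2,3,5], [2,5,4], [3,4,6],
    [3,6,5], [4,5,0], [4,0,6], [5,6,1], [5,1,0], [6,0,2], [6,2,1]]"
  by (simp add: cyclic_torus_def upt_rec)

lemma cyclic_torus_14:
  "cyclic_torus 14 =
   [[0,1,3], [0,3,2], [1,2,4], [1,4,3], [2,3,5], [2,5,4], [3,4,6],
    [3,6,5], [4,5,7], [4,7,6], [5,6,8], [5,8,7], [6,7,9], [6,9,8],
    [7,8,10], [7,10,9], [8,9,11], [8,11,10], [9,10,12], [9,12,11], [10,11,13],
    [10,13,12], [11,12,0], [11,0,13], [12,13,1], [12,1,0], [13,0,2], [13,2,1]]"
  by (simp add: cyclic_torus_def upt_rec)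

lemma single_piece_eq:
  "single_piece =
   [[0,1,3], [8,3,2], [9,3,8], [0,3,9], [1,2,4], [1,4,3], [2,3,5],
    [2,5,4], [7,4,6], [3,4,7], [7,6,5], [3,7,5], [4,5,0], [4,0,6],
    [5,6,1], [5,1,0], [6,8,2], [6,9,8], [6,0,9], [6,2,1]]"
  by (simp add: single_piece_def cyclic_torus_7 subdivide_edge_def)

lemma double_piece_eq:
  "double_piece =
   [[0,1,3], [14,3,2], [15,3,14], [0,3,15], [1,2,4], [1,4,3], [2,3,5],
    [2,5,4], [3,4,6], [3,6,5], [4,5,7], [4,7,6], [5,6,8], [5,8,7],
    [6,7,9], [6,9,8], [7,8,10], [7,10,9], [8,9,11], [8,11,10], [9,10,12],
    [9,12,11], [10,11,13], [10,13,12], [11,12,0], [11,0,13], [12,13,1], [12,1,0],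
    [13,14,2], [13,15,14], [13,0,15], [13,2,1]]"
  by (simp add: double_piece_def cyclic_torus_14 subdivide_edge_def)

lemma single_piece_homeomorphic:
  "geometric_carrier (complex_of single_piece) homeomorphic_space prod_topology circle circle"
proof -
  have "geometric_carrier (complex_of single_piece) homeomorphic_space
      geometric_carrier (complex_of (subdivide_edge 0 2 8 (subdivide_edge 3 6 7 (cyclic_torus 7))))"
    unfolding single_piece_def
    by (rule subdivide_edge_homeomorphic) (simp_all add: cyclic_torus_7 subdivide_edge_def)
  also have "\<dots> homeomorphic_space geometric_carrier (complex_of (subdivide_edge 3 6 7 (cyclic_torus 7)))"
    by (rule subdivide_edge_homeomorphic) (simp_all add: cyclic_torus_7 subdivide_edge_def)
  also have "\<dots> homeomorphic_space geometric_carrier (complex_of (cyclic_torus 7))"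
    by (rule subdivide_edge_homeomorphic) (simp_all add: cyclic_torus_7)
  also have "\<dots> homeomorphic_space prod_topology circle circle"
    by (rule cyclic_torus_homeomorphic) simp
  finally show ?thesis .
qed

lemma double_piece_homeomorphic:
  "geometric_carrier (complex_of double_piece) homeomorphic_space prod_topology circle circle"
proof -
  have "geometric_carrier (complex_of double_piece) homeomorphic_space
      geometric_carrier (complex_of (subdivide_edge 0 2 14 (cyclic_torus 14)))"
    unfolding double_piece_def
    by (rule subdivide_edge_homeomorphic) (simp_all add: cyclic_torus_14 subdivide_edge_def)
  also have "\<dots> homeomorphic_space geometric_carrier (complex_of (cyclic_torus 14))"
    by (rule subdivide_edge_homeomorphic) (simp_all add: cyclic_torus_14)
  also have "\<dots> homeomorphic_space prod_topology circle circle"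
    by (rule cyclic_torus_homeomorphic) simp
  finally show ?thesis .
qed

text \<open>Rewriting rules that rotate the smallest vertex to the front, sort the other two and drop the
  degenerate triangles, so that images of triangles can be compared.\<close>
lemma oriented_triangle_normalize:
  fixes a b c :: nat
  shows "b < a \<Longrightarrow> b < c \<Longrightarrow> oriented_triangle [a, b, c] vs = oriented_triangle [b, c, a] vs"
    and "c < a \<Longrightarrow> c < b \<Longrightarrow> oriented_triangle [a, b, c] vs = oriented_triangle [c, a, b] vs"
    and "c < b \<Longrightarrow> oriented_triangle [a, b, c] vs = - oriented_triangle [a, c, b] vs"
    and "oriented_triangle [a, a, c] vs = 0" "oriented_triangle [a, b, a] vs = 0"
      "oriented_triangle [a, b, b] vs = 0"
  by simp_all

lemma simplicial_map_complex_ofI: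
  assumes "list_all (\<lambda>t. list_ex (\<lambda>u. f ` set t \<subseteq> set u) us) ts"
  shows "simplicial_map (complex_of ts) (complex_of us) f"
  unfolding simplicial_map_def
proof
  fix \<sigma> assume "\<sigma> \<in> complex_of ts"
  then obtain t where t: "t \<in> set ts" "\<sigma> \<noteq> {}" "\<sigma> \<subseteq> set t" by (auto simp: complex_of_def)
  with assms obtain u where u: "u \<in> set us" "f ` set t \<subseteq> set u"
    unfolding list_all_iff list_ex_iff by blast
  have "f ` \<sigma> \<subseteq> set u" using t(3) u(2) by (meson image_mono order_trans)
  with t(2) u(1) show "f ` \<sigma> \<in> complex_of us" by (auto simp: complex_of_def)
qed

lemma marked_quad_complex_ofI:
  assumes "distinct [p, q, r, w]" "f p = 7" "f q = 4" "f r = 1" "f w = 3"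
    and p: "list_ex (\<lambda>t. sort t = sort [r, w, p]) ts" and q: "list_ex (\<lambda>t. sort t = sort [r, w, q]) ts"
    and star: "list_all (\<lambda>t. r \<in> set t \<and> w \<in> set t \<longrightarrow> sort t = sort [r, w, p] \<or> sort t = sort [r, w, q]) ts"
  shows "marked_quad (complex_of ts) f p q r w"
proof -
  have s: "set t = {r, w, y}" if "sort t = sort [r, w, y]" for t y
    using that by (metis set_sort list.set(1) list.simps(15))
  have mem: "{r, w, y} \<in> complex_of ts" if "list_ex (\<lambda>t. sort t = sort [r, w, y]) ts" for y
  proof -
    from that obtain t where "t \<in> set ts" "sort t = sort [r, w, y]" by (auto simp: list_ex_iff)
    with s show ?thesis by (auto simp: complex_of_def)
  qed
  have "\<sigma> \<in> quad_interior p q r w" if "\<sigma> \<in> complex_of ts" "{r, w} \<subseteq> \<sigma>" for \<sigma>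
  proof -
    from that obtain t where t: "t \<in> set ts" "\<sigma> \<subseteq> set t" by (auto simp: complex_of_def)
    with that(2) star have "sort t = sort [r, w, p] \<or> sort t = sort [r, w, q]"
      unfolding list_all_iff by blast
    with s t(2) have "\<sigma> \<subseteq> {r, w, p} \<or> \<sigma> \<subseteq> {r, w, q}" by metis
    with that(2) have "\<sigma> = {r, w} \<or> \<sigma> = {r, w, p} \<or> \<sigma> = {r, w, q}"
      by (elim disjE; cases "p \<in> \<sigma>"; cases "q \<in> \<sigma>") auto
    then show ?thesis by (simp add: quad_interior_def)
  qed
  with assms mem[OF p] mem[OF q] show ?thesis unfolding marked_quad_def by blast
qed

lemma torus7_eq: "torus7 = complex_of torus7_triangles"
  by (simp add: torus7_def complex_of_def)

lemma closed_oriented_single: "closed_oriented single_piece"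
  by (rule closed_orientedI) (simp_all add: single_piece_eq)

lemma closed_oriented_double: "closed_oriented double_piece"
  by (rule closed_orientedI) (simp_all add: double_piece_eq)

lemma torus_piece_single: "torus_piece 1 single_piece single_label 6 3 8 9 2"
  unfolding torus_piece_def
proof (intro conjI allI single_piece_homeomorphic closed_oriented_single)
  show "simplicial_map (complex_of single_piece) torus7 single_label"
    unfolding torus7_eq
    by (rule simplicial_map_complex_ofI) (simp add: single_piece_eq single_label_def torus7_triangles_def)
  show "oriented_sum (map (map single_label) single_piece) ws = 1 * torus7_orientation ws" for ws
    by (simp add: torus7_orientation_eq torus7_triangles_def single_piece_eq single_label_def
        oriented_triangle_normalize numeral_2_eq_2[symmetric] del: oriented_triangle.simps)
  show "marked_quad (complex_of single_piece) single_label 6 3 8 9"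
    by (rule marked_quad_complex_ofI) (simp_all add: single_piece_eq single_label_def)
  show "marked_quad (complex_of single_piece) single_label 6 3 8 2"
    by (rule marked_quad_complex_ofI) (simp_all add: single_piece_eq single_label_def)
qed (simp_all add: single_piece_eq complex_of_def)

lemma torus_piece_double: "torus_piece 2 double_piece double_label 13 3 14 15 2"
  unfolding torus_piece_def
proof (intro conjI allI double_piece_homeomorphic closed_oriented_double)
  show "simplicial_map (complex_of double_piece) torus7 double_label"
    unfolding torus7_eq
    by (rule simplicial_map_complex_ofI) (simp add: double_piece_eq double_label_def torus7_triangles_def)
  show "oriented_sum (map (map double_label) double_piece) ws = 2 * torus7_orientation ws" for ws
    by (simp add: torus7_orientation_eq torus7_triangles_def double_piece_eq double_label_def
        oriented_triangle_normalize numeral_2_eq_2[symmetric] del: oriented_triangle.simps)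
  show "marked_quad (complex_of double_piece) double_label 13 3 14 15"
    by (rule marked_quad_complex_ofI) (simp_all add: double_piece_eq double_label_def)
  show "marked_quad (complex_of double_piece) double_label 13 3 14 2"
    by (rule marked_quad_complex_ofI) (simp_all add: double_piece_eq double_label_def)
qed (simp_all add: double_piece_eq complex_of_def)

lemma card_single_piece: "card (\<Union>(set ` set single_piece)) = 10"
  by (simp add: single_piece_eq card_insert_if)

lemma card_double_piece: "card (\<Union>(set ` set double_piece)) = 16"
  by (simp add: double_piece_eq card_insert_if)

lemma marked_surface_torus:
  "marked_surface 1 1 (complex_of (cyclic_torus 7)) (oriented_sum (cyclic_torus 7)) Suc"
  unfolding marked_surface_def
proof (intro conjI allI ballI exI)
  have c: "closed_oriented (cyclic_torus 7)"
    by (rule closed_orientedI) (simp_all add: cyclic_torus_7)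
  show "abstract_complex (complex_of (cyclic_torus 7))" by (rule abstract_complex_complex_of)
  show "closed_orientable_surface 1 (geometric_carrier (complex_of (cyclic_torus 7)))"
    by (intro closed_orientable_surface.torus cyclic_torus_homeomorphic) simp
  show "surface_orientation (complex_of (cyclic_torus 7)) (oriented_sum (cyclic_torus 7))"
    by (rule surface_orientation_oriented_sum[OF c])
  show "simplicial_map (complex_of (cyclic_torus 7)) torus7 Suc"
    unfolding torus7_eq
    by (rule simplicial_map_complex_ofI) (simp add: cyclic_torus_7 torus7_triangles_def)
  show "simplicial_pushforward (complex_of (cyclic_torus 7)) Suc (oriented_sum (cyclic_torus 7)) ws
      = 1 * torus7_orientation ws" for ws
  proof -
    have "simplicial_pushforward (complex_of (cyclic_torus 7)) Suc (oriented_sum (cyclic_torus 7)) ws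
        = oriented_sum (map (map Suc) (cyclic_torus 7)) ws"
      by (rule pushforward_oriented_sum[OF abstract_complex_complex_of closed_oriented_simplices(1)[OF c]])
    also have "\<dots> = 1 * torus7_orientation ws"
      by (simp add: torus7_orientation_eq torus7_triangles_def cyclic_torus_7
          oriented_triangle_normalize numeral_2_eq_2[symmetric] del: oriented_triangle.simps)
    finally show ?thesis .
  qed
  show "marked_quad (complex_of (cyclic_torus 7)) Suc 6 3 0 2"
    by (rule marked_quad_complex_ofI) (simp_all add: cyclic_torus_7)
  show "oriented_sum (cyclic_torus 7) [0, 2, 6] = 1" by (simp add: cyclic_torus_7)
  show "card \<sigma> \<le> 3" if "\<sigma> \<in> complex_of (cyclic_torus 7)" for \<sigma>
    using closed_oriented_simplices(2)[OF c that] .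
qed

text \<open>Each of the \<open>m\<close> double pieces adds \<open>16 - 4\<close> vertices and each of the \<open>k\<close> single pieces adds
  \<open>10 - 4\<close>.\<close>
lemma marked_surface_exists:
  "\<exists>K \<omega> f. marked_surface (1 + m + k) (1 + 2 * int m + int k) K \<omega> f \<and>
     card (vertices K) = 6 * (1 + 2 * m + k) + 1"
proof (induction k)
  case 0
  show ?case
  proof (induction m)
    case 0
    have "vertices (complex_of (cyclic_torus 7)) = {0, 1, 2, 3, 4, 5, 6}"
      unfolding vertices_complex_of by (auto simp: cyclic_torus_7)
    with marked_surface_torus show ?case
      by (intro exI[of _ "complex_of (cyclic_torus 7)"] exI conjI) (assumption | simp)+
  next
    case (Suc m)
    then obtain K \<omega> f where K: "marked_surface (1 + m + 0) (1 + 2 * int m + int 0) K \<omega> f"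
      "card (vertices K) = 6 * (1 + 2 * m + 0) + 1" by blast
    obtain K' \<omega>' f' where "marked_surface (1 + m + 0 + 1) (1 + 2 * int m + int 0 + 2) K' \<omega>' f'"
      "card (vertices K') + 4 = card (vertices K) + card (\<Union>(set ` set double_piece))"
      by (rule glue_torus_piece[OF K(1) torus_piece_double])
    with K(2) show ?case by (intro exI[of _ K'] exI[of _ \<omega>'] exI[of _ f']) (simp add: card_double_piece)
  qed
next
  case (Suc k)
  then obtain K \<omega> f where K: "marked_surface (1 + m + k) (1 + 2 * int m + int k) K \<omega> f"
    "card (vertices K) = 6 * (1 + 2 * m + k) + 1" by blast
  obtain K' \<omega>' f' where "marked_surface (1 + m + k + 1) (1 + 2 * int m + int k + 1) K' \<omega>' f'"
    "card (vertices K') + 4 = card (vertices K) + card (\<Union>(set ` set single_piece))"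
    by (rule glue_torus_piece[OF K(1) torus_piece_single])
  with K(2) show ?case
    by (intro exI[of _ K'] exI[of _ \<omega>'] exI[of _ f']) (simp add: card_single_piece add_ac)
qed

text \<open>The orientation is reversed when \<open>d\<close> is negative.\<close>
theorem theorem10:
  fixes g i :: nat and d :: int
  assumes "g \<ge> 2" and "i \<le> g - 2" and "\<bar>d\<bar> = int (g + i)"
  shows "\<exists>(M :: (nat \<Rightarrow> real) topology) (K :: nat set set) \<omega> f.
           closed_orientable_surface g M \<and>
           triangulation_of K M \<and>
           int (card (vertices K)) = 6 * \<bar>d\<bar> + 1 \<and>
           surface_orientation K \<omega> \<and>
           simplicial_map K torus7 f \<and>
           has_simplicial_degree K \<omega> torus7 torus7_orientation f d"
proof -
  \<comment> \<open>\<open>k\<close> steps with a single piece and \<open>i\<close> steps with a double piece\<close>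
  define k where "k = g - 1 - i"
  have g: "g = 1 + i + k" and d: "\<bar>d\<bar> = 1 + 2 * int i + int k" using assms by (simp_all add: k_def)
  obtain K \<omega> f where m: "marked_surface (1 + i + k) (1 + 2 * int i + int k) K \<omega> f"
    and card: "card (vertices K) = 6 * (1 + 2 * i + k) + 1"
    using marked_surface_exists by blast
  have K: "abstract_complex K" "closed_orientable_surface g (geometric_carrier K)"
      "\<forall>\<sigma>\<in>K. card \<sigma> \<le> 3" "surface_orientation K \<omega>" "simplicial_map K torus7 f"
      "\<forall>ws. simplicial_pushforward K f \<omega> ws = \<bar>d\<bar> * torus7_orientation ws"
    using m unfolding marked_surface_def g d by blast+
  define \<omega>' where "\<omega>' = (if 0 \<le> d then \<omega> else (\<lambda>vs. - \<omega> vs))"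
  have "surface_orientation K \<omega>'"
    using K(4) simplicial_cycles_uminus[of \<omega> 2 K] unfolding \<omega>'_def surface_orientation_def by auto
  moreover have "simplicial_pushforward K f \<omega>' ws = d * torus7_orientation ws" for ws
    using K(6) by (simp add: \<omega>'_def pushforward_uminus)
  then have "has_simplicial_degree K \<omega>' torus7 torus7_orientation f d"
    using K(3) closed_oriented_simplices(2)[OF closed_oriented_torus7] surface_orientation_oriented_sum[OF closed_oriented_torus7]
    by (intro has_simplicial_degreeI) (auto simp: surface_orientation_def torus7_eq torus7_orientation_eq)
  moreover have "int (card (vertices K)) = 6 * \<bar>d\<bar> + 1" using card d by simp
  moreover have "triangulation_of K (geometric_carrier K)"
    using K(1) by (simp add: triangulation_of_def)
  ultimately show ?thesis using K(2,5) by blast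
qed

end
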